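(* Let $\bar{\mathbb{F}}\in\{\mathbb{A},\ldots,\mathbb{Z}\}$ be one of the $26$ families listed in the context, with fixed admissible parameters, and let $B_{\bar{\mathbb{F}}}$ be the corresponding algebra. For normal monomials \[ M=x_1^ax_2^by_1^cy_2^d,\qquad N=x_1^{a'}x_2^{b'}y_1^{c'}y_2^{d'}\qquad(a,b,c,d,a',b',c',d'\ge0\text{ integers}) \] one has \[ \mathrm{NF}_{\bar{\mathbb{F}}}(MN)=\sum_{A,B,C,D\ge0}\mathfrak{m}_{\bar{\mathbb{F}}}\begin{bmatrix}a,b;c,d\\ a',b';c',d'\\ A,B;C,D\end{bmatrix}x_1^Ax_2^By_1^Cy_2^D, \] where the product constants are given by \[ \mathfrak{m}_{\bar{\mathbb{F}}}\begin{bmatrix}a,b;c,d\\ a',b';c',d'\\ A,B;C,D\end{bmatrix} =\sum_{\alpha,\beta,\gamma,\delta\ge0}\ \sum_{r,s\ge0}\Theta_{\bar{\mathbb{F}}}(a',b';c,d;\alpha,\beta;\gamma,\delta)\,\Lambda_{q_{\bar{\mathbb{F}}},r_{\bar{\mathbb{F}}}}(b,\alpha;r)\,\Lambda_{p_{\bar{\mathbb{F}}},s_{\bar{\mathbb{F}}}}(\delta,c';s)\,\delta_{A,a+\alpha+r}\,\delta_{B,b-r+\beta}\,\delta_{C,\gamma+c'+s}\,\delta_{D,\delta-s+d'} . \]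
   Context: **Ground field.** $\Bbbk$ is an algebraically closed field of characteristic zero; algebras are associative and unital. $\delta_{u,v}$ (with two subscripts) is the Kronecker delta; $\delta$ without subscripts is an integer index. **The families.** Each family $\bar{\mathbb{F}}$ is given by scalars $(q_{\bar{\mathbb{F}}},r_{\bar{\mathbb{F}}})$, $(p_{\bar{\mathbb{F}}},s_{\bar{\mathbb{F}}})$ and finite sets $\mathscr{K}_{i,s}^{\bar{\mathbb{F}}}\subseteq\Bbbk\times\{1,2\}\times\{1,2\}$, $i,s\in\{1,2\}$, of triples $(\lambda;t,\ell)$. The algebra $B_{\bar{\mathbb{F}}}$ is generated by $x_1,x_2,y_1,y_2$ with the six defining relations \[ x_2x_1=q_{\bar{\mathbb{F}}}x_1x_2+r_{\bar{\mathbb{F}}}x_1^2,\quad y_2y_1=p_{\bar{\mathbb{F}}}y_1y_2+s_{\bar{\mathbb{F}}}y_1^2,\quad y_ix_s=\sum_{(\lambda;t,\ell)\in\mathscr{K}_{i,s}^{\bar{\mathbb{F}}}}\lambda\,x_ty_\ell\ \ (i,s\in\{1,2\}). \] Values of $(q_{\bar{\mathbb{F}}},r_{\bar{\mathbb{F}}})$; $(p_{\bar{\mathbb{F}}},s_{\bar{\mathbb{F}}})$: $\mathbb{A}$: $(1,0);(1,1)$. $\mathbb{B},\mathbb{C}$: $(p,0);(p,0)$. $\mathbb{D},\mathbb{E},\mathbb{F}$: $(-1,0);(p,0)$. $\mathbb{G}$: $(1,0);(p,0)$. $\mathbb{H}$: $(1,1);(-1,0)$. $\mathbb{I},\mathbb{J},\mathbb{K},\mathbb{L}$: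 $(q,0);(-1,0)$. $\mathbb{M},\mathbb{N},\mathbb{O},\mathbb{P},\mathbb{Q},\mathbb{R},\mathbb{S},\mathbb{T},\mathbb{U}$: $(-1,0);(-1,0)$. $\mathbb{V},\mathbb{W},\mathbb{X},\mathbb{Y}$: $(1,0);(-1,0)$. $\mathbb{Z}$: $(-1,0);(1,0)$. Sets $\mathscr{K}_{1,1}\mid\mathscr{K}_{1,2}\mid\mathscr{K}_{2,1}\mid\mathscr{K}_{2,2}$ in this order: - $\mathbb{A}$: $(1;1,1)\mid(1;2,1),(1;1,2)\mid(1;1,2)\mid(-2;2,1),(-1;1,2),(1;2,2)$ - $\mathbb{B}$: $(1;2,2)\mid(1;1,2)\mid(-1;2,1)\mid(1;1,1)$ - $\mathbb{C}$: $(-1;1,1),(p^2;2,1),(1;1,2),(-p;2,2)\mid(-p;1,1),(1;2,1),(1;1,2),(-p;2,2)\mid(-p;1,1),(-2p^2;2,1),(p;1,2),(-p;2,2)\mid(-p;1,1),(p^2;2,1),(1;1,2),(-1;2,2)$ - $\mathbb{D}$: $(-p;1,1)\mid(-p^2;2,1),(1;1,2)\mid(p;1,2)\mid(1;1,1),(1;2,2)$ - $\mathbb{E}$: $(1;1,2),(1;2,2)\mid(1;1,2),(-1;2,2)\mid(-1;1,1),(1;2,1)\mid(1;1,1),(1;2,1)$ - $\mathbb{F}$: $(-1;1,1),(-p;2,1),(1;1,2),(-1;2,2)\mid(-p;1,1),(1;2,1),(1;1,2),(1;2,2)\mid(-p;1,1),(p;2,1),(p;1,2),(1;2,2)\mid(-p;1,1),(-p;2,1),(1;1,2),(-p;2,2)$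 - $\mathbb{G}$: $(p;1,1)\mid(p;1,1),(p^2;2,1),(1;1,2)\mid(p;1,2)\mid(f;1,1),(-1;1,2),(1;2,2)$ - $\mathbb{H}$: $(1;1,2)\mid(f;1,2),(1;2,2)\mid(1;1,1)\mid(f;1,1),(1;2,1)$ - $\mathbb{I}$: $(-q;1,1),(-q;2,1),(1;1,2),(-q;2,2)\mid(1;1,1),(1;2,1),(1;1,2),(-q;2,2)\mid(1;1,1),(q;2,1),(q;1,2),(-q;2,2)\mid(-1;1,1),(-q;2,1),(1;1,2),(-1;2,2)$ - $\mathbb{J}$: $(1;2,1),(1;2,2)\mid(-1;1,1),(1;1,2)\mid(1;2,1),(-1;2,2)\mid(1;1,1),(1;1,2)$ - $\mathbb{K}$: $(1;1,1)\mid(1;2,2)\mid(1;1,2)\mid(f;2,1)$ - $\mathbb{L}$: $(f;1,2)\mid(1;2,2)\mid(f;1,1)\mid(1;2,1)$ - $\mathbb{M}$: $(1;2,1),(1;1,2)\mid(f;1,1),(-1;2,2)\mid(1;1,1),(-1;2,2)\mid(-1;2,1),(-f;1,2)$ - $\mathbb{N}$: $(-g;2,1),(f;2,2)\mid(g;1,1),(f;1,2)\mid(f;2,1),(-g;2,2)\mid(f;1,1),(g;1,2)$ - $\mathbb{O}$: $(1;1,1),(f;2,2)\mid(-1;2,1),(1;1,2)\mid(f;2,1),(-1;1,2)\mid(1;1,1),(1;2,2)$ - $\mathbb{P}$: $(1;1,2),(f;2,2)\mid(1;1,2),(1;2,2)\mid(1;1,1),(-f;2,1)\mid(-1;1,1),(1;2,1)$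 - $\mathbb{Q}$: $(1;1,2)\mid(1;1,1),(1;2,1),(1;1,2)\mid(-1;1,1)\mid(1;1,1),(-1;1,2),(1;2,2)$ - $\mathbb{R}$: $(1;1,1),(1;2,1),(1;1,2)\mid(1;1,2)\mid(1;2,1)\mid(-1;2,1),(-1;1,2),(1;2,2)$ - $\mathbb{S}$: $(-1;1,1),(1;2,1),(1;1,2),(1;2,2)\mid(1;1,1),(-1;2,1),(1;1,2),(1;2,2)\mid(1;1,1),(1;2,1),(-1;1,2),(1;2,2)\mid(1;1,1),(1;2,1),(1;1,2),(-1;2,2)$ - $\mathbb{T}$: $(-1;1,1),(1;2,1),(1;1,2),(1;2,2)\mid(1;1,1),(-1;2,1),(1;1,2),(1;2,2)\mid(1;1,1),(1;2,1),(1;1,2),(-1;2,2)\mid(1;1,1),(1;2,1),(-1;1,2),(1;2,2)$ - $\mathbb{U}$: $(-1;1,1),(1;2,1),(1;1,2),(1;2,2)\mid(1;1,1),(1;2,1),(1;1,2),(-1;2,2)\mid(1;1,1),(1;2,1),(-1;1,2),(1;2,2)\mid(1;1,1),(-1;2,1),(1;1,2),(1;2,2)$ - $\mathbb{V}$: $(1;2,1),(1;1,2)\mid(1;2,1)\mid(-1;1,1),(1;2,1)\mid(1;2,2)$ - $\mathbb{W}$: $(f;2,1),(1;1,2)\mid(1;1,1),(-1;2,2)\mid(1;1,1),(f;2,2)\mid(-1;2,1),(1;1,2)$ - $\mathbb{X}$: $(1;1,2)\mid(1;1,2),(1;2,2)\mid(1;1,1)\mid(1;1,1),(1;2,1)$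 - $\mathbb{Y}$: $(1;1,1)\mid(f;1,1),(-1;2,1),(1;1,2)\mid(1;1,2)\mid(1;1,1),(f;1,2),(-1;2,2)$ - $\mathbb{Z}$: $(1;1,1),(1;2,2)\mid(1;2,1),(1;1,2)\mid(f;2,1),(-1;1,2)\mid(f;1,1),(-1;2,2)$ **Admissible parameters.** The parameters $p,q,f,g\in\Bbbk$ occurring in a family are assumed to be such that $q_{\bar{\mathbb{F}}},p_{\bar{\mathbb{F}}}\neq0$ and $B_{\bar{\mathbb{F}}}$ is a trimmed double extension of $R=\Bbbk\{x_1,x_2\}/\langle x_2x_1-q_{\bar{\mathbb{F}}}x_1x_2-r_{\bar{\mathbb{F}}}x_1^2\rangle$ (via $x_s\mapsto x_s$). Here a trimmed double extension of $R$ is an algebra $B$ containing $R$ as a subalgebra, generated by $R$ and elements $y_1,y_2$, such that: $y_2y_1=p_{12}y_1y_2+p_{11}y_1^2$ with $p_{12}\in\Bbbk^\times,p_{11}\in\Bbbk$; $y_ir=\sum_{j=1}^2\sigma_{ij}(r)y_j$ for all $r\in R$, for some maps $\sigma_{ij}:R\to R$; $B$ is a free left $R$-module with basis $\{y_1^iy_2^j\}_{i,j\ge0}$ and a free right $R$-module with basis $\{y_2^iy_1^j\}_{i,j\ge0}$; and $y_1R+y_2R+R=Ry_1+Ry_2+R$. **Normal form.** Consequently the monomials $x_1^ax_2^by_1^cy_2^d$ ($a,b,c,d\ge0$) form a $\Bbbk$-basis of $B_{\bar{\mathbb{F}}}$, and $\mathrm{NF}_{\bar{\mathbb{F}}}(\omega)$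 denotes the unique (finite) expansion of the element represented by $\omega$ in this basis. **Coefficients.** The scalars $\Theta_{\bar{\mathbb{F}}}(a,b;c,d;\alpha,\beta;\gamma,\delta)$ are the coefficients in $\mathrm{NF}_{\bar{\mathbb{F}}}(y_1^cy_2^dx_1^ax_2^b)=\sum_{\alpha,\beta,\gamma,\delta\ge0}\Theta_{\bar{\mathbb{F}}}(a,b;c,d;\alpha,\beta;\gamma,\delta)x_1^\alpha x_2^\beta y_1^\gamma y_2^\delta$. For $q\in\Bbbk^\times$: $[n]_q:=1+q+\cdots+q^{n-1}$, $[0]_q:=0$; $\begin{bmatrix}0\\0\end{bmatrix}_q=1$, $\begin{bmatrix}n\\k\end{bmatrix}_q=0$ if $k<0$ or $k>n$, $\begin{bmatrix}n+1\\k\end{bmatrix}_q=\begin{bmatrix}n\\k-1\end{bmatrix}_q+q^k\begin{bmatrix}n\\k\end{bmatrix}_q$; $[m]_q^{\overline{k}}:=\prod_{j=0}^{k-1}[m+j]_q$; $\Lambda_{q,r}(n,m;k):=r^kq^{m(n-k)}\begin{bmatrix}n\\k\end{bmatrix}_q[m]_q^{\overline{k}}$, equal to $0$ if $k>n$ (with $0^0=1$). *)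

theory Defs
  imports
    "HOL-Library.Poly_Mapping"
    "HOL-Algebra.Generated_Rings"
    "HOL-Algebra.Algebraic_Closure_Type"
begin

section \<open>Free associative algebras and algebras given by generators and relations\<close>

text \<open>The free monoid, written additively because \<^typ>\<open>'a \<Rightarrow>\<^sub>0 'b\<close> is the convolution (monoid) ring of
  an additively written, not necessarily commutative, monoid \<^typ>\<open>'a\<close>.\<close>

datatype 'g fword = Word "'g list"

instantiation fword :: (type) monoid_add
begin

definition zero_fword :: "'g fword" where
  "zero_fword = Word []"

primrec plus_fword :: "'g fword \<Rightarrow> 'g fword \<Rightarrow> 'g fword" where
  "plus_fword (Word u) v = (case v of Word w \<Rightarrow> Word (u @ w))"

instance
proof
  fix u v w :: "'g fword"
  show "u + v + w = u + (v + w)"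
    by (cases u; cases v; cases w) simp
  show "0 + u = u" "u + 0 = u"
    by (cases u; simp add: zero_fword_def)+
qed

end

type_synonym ('g, 'k) free_alg = "'g fword \<Rightarrow>\<^sub>0 'k"

definition letter :: "'g \<Rightarrow> ('g, 'k::field) free_alg" where
  "letter s = Poly_Mapping.single (Word [s]) 1"

definition scalar :: "'k::field \<Rightarrow> ('g, 'k) free_alg" where
  "scalar c = Poly_Mapping.single 0 c"

text \<open>\<^const>\<open>genideal\<close> is the generated two-sided ideal. The scalars of the free algebra lie in the
  ring itself, so ring ideals and algebra ideals coincide.\<close>

definition presented_alg :: "('g, 'k::field) free_alg set \<Rightarrow> ('g, 'k) free_alg set ring" where
  "presented_alg Rel =
     ring_of_type_algebra Quot (genideal ring_of_type_algebra Rel)"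

definition quot_class :: "('g, 'k::field) free_alg set \<Rightarrow> ('g, 'k) free_alg \<Rightarrow> ('g, 'k) free_alg set" where
  "quot_class Rel w =
     genideal ring_of_type_algebra Rel +>\<^bsub>ring_of_type_algebra\<^esub> w"


section \<open>Trimmed double extensions\<close>

text \<open>An associative unital algebra over the field \<^typ>\<open>'k\<close>, given by its structure map \<open>emb\<close> into
  the centre.\<close>

locale assoc_alg = ring B for B :: "'a ring" (structure) +
  fixes emb :: "'k::field \<Rightarrow> 'a"
  assumes emb_closed: "emb c \<in> carrier B"
    and emb_one: "emb 1 = \<one>"
    and emb_add: "emb (c + d) = emb c \<oplus> emb d"
    and emb_mult: "emb (c * d) = emb c \<otimes> emb d"
    and emb_central: "u \<in> carrier B \<Longrightarrow> emb c \<otimes> u = u \<otimes> emb c"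

text \<open>\<open>m\<close> is a basis, as an indexed family, of \<open>B\<close> as a left (right) module over the subring \<open>R\<close>.\<close>

definition left_basis :: "'a ring \<Rightarrow> 'a set \<Rightarrow> ('i \<Rightarrow> 'a) \<Rightarrow> bool" where
  "left_basis B R m \<longleftrightarrow>
     (\<forall>k. m k \<in> carrier B) \<and>
     (\<forall>u\<in>carrier B. \<exists>!c. range c \<subseteq> R \<and> finite {k. c k \<noteq> \<zero>\<^bsub>B\<^esub>} \<and>
        u = (\<Oplus>\<^bsub>B\<^esub>k\<in>{k. c k \<noteq> \<zero>\<^bsub>B\<^esub>}. c k \<otimes>\<^bsub>B\<^esub> m k))"

definition right_basis :: "'a ring \<Rightarrow> 'a set \<Rightarrow> ('i \<Rightarrow> 'a) \<Rightarrow> bool" where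
  "right_basis B R m \<longleftrightarrow>
     (\<forall>k. m k \<in> carrier B) \<and>
     (\<forall>u\<in>carrier B. \<exists>!c. range c \<subseteq> R \<and> finite {k. c k \<noteq> \<zero>\<^bsub>B\<^esub>} \<and>
        u = (\<Oplus>\<^bsub>B\<^esub>k\<in>{k. c k \<noteq> \<zero>\<^bsub>B\<^esub>}. m k \<otimes>\<^bsub>B\<^esub> c k))"

datatype ind = I1 | I2

locale trimmed_double_extension = assoc_alg B emb
  for B :: "'a ring" (structure) and emb :: "'k::field \<Rightarrow> 'a" +
  fixes R :: "'a set" and y :: "ind \<Rightarrow> 'a"
  assumes subalgebra: "subring R B" "range emb \<subseteq> R"
    and y_closed: "y i \<in> carrier B"
    and generated: "generate_ring B (R \<union> range y) = carrier B"
    and y_relation: "\<exists>p12 p11. p12 \<noteq> 0 \<and>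
      y I2 \<otimes> y I1 = emb p12 \<otimes> (y I1 \<otimes> y I2) \<oplus> emb p11 \<otimes> (y I1 [^] (2::nat))"
    and commutation: "\<exists>\<sigma> :: ind \<Rightarrow> ind \<Rightarrow> 'a \<Rightarrow> 'a. (\<forall>i j. \<forall>r\<in>R. \<sigma> i j r \<in> R) \<and>
      (\<forall>i. \<forall>r\<in>R. y i \<otimes> r = \<sigma> i I1 r \<otimes> y I1 \<oplus> \<sigma> i I2 r \<otimes> y I2)"
    and left_free: "left_basis B R (\<lambda>(i::nat, j::nat). y I1 [^] i \<otimes> y I2 [^] j)"
    and right_free: "right_basis B R (\<lambda>(i::nat, j::nat). y I2 [^] i \<otimes> y I1 [^] j)"
    and trimmed:
      "{y I1 \<otimes> r1 \<oplus> y I2 \<otimes> r2 \<oplus> r0 |r1 r2 r0. r1 \<in> R \<and> r2 \<in> R \<and> r0 \<in> R} =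
       {r1 \<otimes> y I1 \<oplus> r2 \<otimes> y I2 \<oplus> r0 |r1 r2 r0. r1 \<in> R \<and> r2 \<in> R \<and> r0 \<in> R}"


section \<open>The 26 families\<close>

datatype family =
    FamA | FamB | FamC | FamD | FamE | FamF | FamG | FamH | FamI
  | FamJ | FamK | FamL | FamM | FamN | FamO | FamP | FamQ | FamR
  | FamS | FamT | FamU | FamV | FamW | FamX | FamY | FamZ

text \<open>The pairs $(q_F, r_F)$ and $(p_F, s_F)$.\<close>

primrec x_params :: "family \<Rightarrow> 'k::field \<Rightarrow> 'k \<Rightarrow> 'k \<times> 'k" where
  "x_params FamA p q = (1, 0)"
| "x_params FamB p q = (p, 0)"
| "x_params FamC p q = (p, 0)"
| "x_params FamD p q = (-1, 0)"
| "x_params FamE p q = (-1, 0)"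
| "x_params FamF p q = (-1, 0)"
| "x_params FamG p q = (1, 0)"
| "x_params FamH p q = (1, 1)"
| "x_params FamI p q = (q, 0)"
| "x_params FamJ p q = (q, 0)"
| "x_params FamK p q = (q, 0)"
| "x_params FamL p q = (q, 0)"
| "x_params FamM p q = (-1, 0)"
| "x_params FamN p q = (-1, 0)"
| "x_params FamO p q = (-1, 0)"
| "x_params FamP p q = (-1, 0)"
| "x_params FamQ p q = (-1, 0)"
| "x_params FamR p q = (-1, 0)"
| "x_params FamS p q = (-1, 0)"
| "x_params FamT p q = (-1, 0)"
| "x_params FamU p q = (-1, 0)"
| "x_params FamV p q = (1, 0)"
| "x_params FamW p q = (1, 0)"
| "x_params FamX p q = (1, 0)"
| "x_params FamY p q = (1, 0)"
| "x_params FamZ p q = (-1, 0)"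

primrec y_params :: "family \<Rightarrow> 'k::field \<Rightarrow> 'k \<Rightarrow> 'k \<times> 'k" where
  "y_params FamA p q = (1, 1)"
| "y_params FamB p q = (p, 0)"
| "y_params FamC p q = (p, 0)"
| "y_params FamD p q = (p, 0)"
| "y_params FamE p q = (p, 0)"
| "y_params FamF p q = (p, 0)"
| "y_params FamG p q = (p, 0)"
| "y_params FamH p q = (-1, 0)"
| "y_params FamI p q = (-1, 0)"
| "y_params FamJ p q = (-1, 0)"
| "y_params FamK p q = (-1, 0)"
| "y_params FamL p q = (-1, 0)"
| "y_params FamM p q = (-1, 0)"
| "y_params FamN p q = (-1, 0)"
| "y_params FamO p q = (-1, 0)"
| "y_params FamP p q = (-1, 0)"
| "y_params FamQ p q = (-1, 0)"
| "y_params FamR p q = (-1, 0)"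
| "y_params FamS p q = (-1, 0)"
| "y_params FamT p q = (-1, 0)"
| "y_params FamU p q = (-1, 0)"
| "y_params FamV p q = (-1, 0)"
| "y_params FamW p q = (-1, 0)"
| "y_params FamX p q = (-1, 0)"
| "y_params FamY p q = (-1, 0)"
| "y_params FamZ p q = (1, 0)"

text \<open>The four sets $K_{1,1}, K_{1,2}, K_{2,1}, K_{2,2}$; a triple \<open>(l, t, u)\<close> in $K_{i,s}$ stands for
  the term $l\, x_t y_u$ of $y_i x_s$.\<close>

primrec couplings :: "family \<Rightarrow> 'k::field \<Rightarrow> 'k \<Rightarrow> 'k \<Rightarrow> 'k \<Rightarrow>
    ('k \<times> ind \<times> ind) set \<times> ('k \<times> ind \<times> ind) set \<times>
    ('k \<times> ind \<times> ind) set \<times> ('k \<times> ind \<times> ind) set" where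
  "couplings FamA p q f g =
    ({(1, I1, I1)},
     {(1, I2, I1), (1, I1, I2)},
     {(1, I1, I2)},
     {(-2, I2, I1), (-1, I1, I2), (1, I2, I2)})"
| "couplings FamB p q f g =
    ({(1, I2, I2)},
     {(1, I1, I2)},
     {(-1, I2, I1)},
     {(1, I1, I1)})"
| "couplings FamC p q f g =
    ({(-1, I1, I1), (p^2, I2, I1), (1, I1, I2), (-p, I2, I2)},
     {(-p, I1, I1), (1, I2, I1), (1, I1, I2), (-p, I2, I2)},
     {(-p, I1, I1), (- 2 * p^2, I2, I1), (p, I1, I2), (-p, I2, I2)},
     {(-p, I1, I1), (p^2, I2, I1), (1, I1, I2), (-1, I2, I2)})"
| "couplings FamD p q f g =
    ({(-p, I1, I1)},
     {(- (p^2), I2, I1), (1, I1, I2)},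
     {(p, I1, I2)},
     {(1, I1, I1), (1, I2, I2)})"
| "couplings FamE p q f g =
    ({(1, I1, I2), (1, I2, I2)},
     {(1, I1, I2), (-1, I2, I2)},
     {(-1, I1, I1), (1, I2, I1)},
     {(1, I1, I1), (1, I2, I1)})"
| "couplings FamF p q f g =
    ({(-1, I1, I1), (-p, I2, I1), (1, I1, I2), (-1, I2, I2)},
     {(-p, I1, I1), (1, I2, I1), (1, I1, I2), (1, I2, I2)},
     {(-p, I1, I1), (p, I2, I1), (p, I1, I2), (1, I2, I2)},
     {(-p, I1, I1), (-p, I2, I1), (1, I1, I2), (-p, I2, I2)})"
| "couplings FamG p q f g =
    ({(p, I1, I1)},
     {(p, I1, I1), (p^2, I2, I1), (1, I1, I2)},
     {(p, I1, I2)},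
     {(f, I1, I1), (-1, I1, I2), (1, I2, I2)})"
| "couplings FamH p q f g =
    ({(1, I1, I2)},
     {(f, I1, I2), (1, I2, I2)},
     {(1, I1, I1)},
     {(f, I1, I1), (1, I2, I1)})"
| "couplings FamI p q f g =
    ({(-q, I1, I1), (-q, I2, I1), (1, I1, I2), (-q, I2, I2)},
     {(1, I1, I1), (1, I2, I1), (1, I1, I2), (-q, I2, I2)},
     {(1, I1, I1), (q, I2, I1), (q, I1, I2), (-q, I2, I2)},
     {(-1, I1, I1), (-q, I2, I1), (1, I1, I2), (-1, I2, I2)})"
| "couplings FamJ p q f g =
    ({(1, I2, I1), (1, I2, I2)},
     {(-1, I1, I1), (1, I1, I2)},
     {(1, I2, I1), (-1, I2, I2)},
     {(1, I1, I1), (1, I1, I2)})"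
| "couplings FamK p q f g =
    ({(1, I1, I1)},
     {(1, I2, I2)},
     {(1, I1, I2)},
     {(f, I2, I1)})"
| "couplings FamL p q f g =
    ({(f, I1, I2)},
     {(1, I2, I2)},
     {(f, I1, I1)},
     {(1, I2, I1)})"
| "couplings FamM p q f g =
    ({(1, I2, I1), (1, I1, I2)},
     {(f, I1, I1), (-1, I2, I2)},
     {(1, I1, I1), (-1, I2, I2)},
     {(-1, I2, I1), (-f, I1, I2)})"
| "couplings FamN p q f g =
    ({(-g, I2, I1), (f, I2, I2)},
     {(g, I1, I1), (f, I1, I2)},
     {(f, I2, I1), (-g, I2, I2)},
     {(f, I1, I1), (g, I1, I2)})"
| "couplings FamO p q f g =
    ({(1, I1, I1), (f, I2, I2)},
     {(-1, I2, I1), (1, I1, I2)},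
     {(f, I2, I1), (-1, I1, I2)},
     {(1, I1, I1), (1, I2, I2)})"
| "couplings FamP p q f g =
    ({(1, I1, I2), (f, I2, I2)},
     {(1, I1, I2), (1, I2, I2)},
     {(1, I1, I1), (-f, I2, I1)},
     {(-1, I1, I1), (1, I2, I1)})"
| "couplings FamQ p q f g =
    ({(1, I1, I2)},
     {(1, I1, I1), (1, I2, I1), (1, I1, I2)},
     {(-1, I1, I1)},
     {(1, I1, I1), (-1, I1, I2), (1, I2, I2)})"
| "couplings FamR p q f g =
    ({(1, I1, I1), (1, I2, I1), (1, I1, I2)},
     {(1, I1, I2)},
     {(1, I2, I1)},
     {(-1, I2, I1), (-1, I1, I2), (1, I2, I2)})"
| "couplings FamS p q f g =
    ({(-1, I1, I1), (1, I2, I1), (1, I1, I2), (1, I2, I2)},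
     {(1, I1, I1), (-1, I2, I1), (1, I1, I2), (1, I2, I2)},
     {(1, I1, I1), (1, I2, I1), (-1, I1, I2), (1, I2, I2)},
     {(1, I1, I1), (1, I2, I1), (1, I1, I2), (-1, I2, I2)})"
| "couplings FamT p q f g =
    ({(-1, I1, I1), (1, I2, I1), (1, I1, I2), (1, I2, I2)},
     {(1, I1, I1), (-1, I2, I1), (1, I1, I2), (1, I2, I2)},
     {(1, I1, I1), (1, I2, I1), (1, I1, I2), (-1, I2, I2)},
     {(1, I1, I1), (1, I2, I1), (-1, I1, I2), (1, I2, I2)})"
| "couplings FamU p q f g =
    ({(-1, I1, I1), (1, I2, I1), (1, I1, I2), (1, I2, I2)},
     {(1, I1, I1), (1, I2, I1), (1, I1, I2), (-1, I2, I2)},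
     {(1, I1, I1), (1, I2, I1), (-1, I1, I2), (1, I2, I2)},
     {(1, I1, I1), (-1, I2, I1), (1, I1, I2), (1, I2, I2)})"
| "couplings FamV p q f g =
    ({(1, I2, I1), (1, I1, I2)},
     {(1, I2, I1)},
     {(-1, I1, I1), (1, I2, I1)},
     {(1, I2, I2)})"
| "couplings FamW p q f g =
    ({(f, I2, I1), (1, I1, I2)},
     {(1, I1, I1), (-1, I2, I2)},
     {(1, I1, I1), (f, I2, I2)},
     {(-1, I2, I1), (1, I1, I2)})"
| "couplings FamX p q f g =
    ({(1, I1, I2)},
     {(1, I1, I2), (1, I2, I2)},
     {(1, I1, I1)},
     {(1, I1, I1), (1, I2, I1)})"
| "couplings FamY p q f g =
    ({(1, I1, I1)},
     {(f, I1, I1), (-1, I2, I1), (1, I1, I2)},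
     {(1, I1, I2)},
     {(1, I1, I1), (f, I1, I2), (-1, I2, I2)})"
| "couplings FamZ p q f g =
    ({(1, I1, I1), (1, I2, I2)},
     {(1, I2, I1), (1, I1, I2)},
     {(f, I2, I1), (-1, I1, I2)},
     {(f, I1, I1), (-1, I2, I2)})"

definition coupling :: "family \<Rightarrow> 'k::field \<Rightarrow> 'k \<Rightarrow> 'k \<Rightarrow> 'k \<Rightarrow> ind \<Rightarrow> ind \<Rightarrow> ('k \<times> ind \<times> ind) set" where
  "coupling F p q f g i s =
     (case couplings F p q f g of (K11, K12, K21, K22) \<Rightarrow>
        (case i of I1 \<Rightarrow> (case s of I1 \<Rightarrow> K11 | I2 \<Rightarrow> K12)
                 | I2 \<Rightarrow> (case s of I1 \<Rightarrow> K21 | I2 \<Rightarrow> K22)))"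

definition plane_relation :: "(ind \<Rightarrow> ('g, 'k::field) free_alg) \<Rightarrow> 'k \<times> 'k \<Rightarrow> ('g, 'k) free_alg" where
  "plane_relation z qr =
     z I2 * z I1 - (scalar (fst qr) * z I1 * z I2 + scalar (snd qr) * z I1 ^ 2)"

datatype gen = Gen_x ind | Gen_y ind

abbreviation xv :: "ind \<Rightarrow> (gen, 'k::field) free_alg" where
  "xv s \<equiv> letter (Gen_x s)"

abbreviation yv :: "ind \<Rightarrow> (gen, 'k::field) free_alg" where
  "yv i \<equiv> letter (Gen_y i)"

definition B_rels :: "family \<Rightarrow> 'k::field \<Rightarrow> 'k \<Rightarrow> 'k \<Rightarrow> 'k \<Rightarrow> (gen, 'k) free_alg set" where
  "B_rels F p q f g =
     {plane_relation xv (x_params F p q), plane_relation yv (y_params F p q)} \<union>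
     {yv i * xv s - (\<Sum>(l, t, u)\<in>coupling F p q f g i s. scalar l * xv t * yv u) |i s. True}"

definition R_rels :: "family \<Rightarrow> 'k::field \<Rightarrow> 'k \<Rightarrow> (ind, 'k) free_alg set" where
  "R_rels F p q = {plane_relation letter (x_params F p q)}"

definition B_alg :: "family \<Rightarrow> 'k::field \<Rightarrow> 'k \<Rightarrow> 'k \<Rightarrow> 'k \<Rightarrow> (gen, 'k) free_alg set ring" where
  "B_alg F p q f g = presented_alg (B_rels F p q f g)"

definition R_alg :: "family \<Rightarrow> 'k::field \<Rightarrow> 'k \<Rightarrow> (ind, 'k) free_alg set ring" where
  "R_alg F p q = presented_alg (R_rels F p q)"

text \<open>Here \<open>y\<^sub>1\<close>, \<open>y\<^sub>2\<close> of the double extension are the given generators of the algebra, and its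
  subalgebra is the image of \<open>R\<close> under an injective algebra homomorphism \<open>h\<close> with
  \<open>x\<^sub>s \<mapsto> x\<^sub>s\<close>.\<close>

definition admissible :: "family \<Rightarrow> 'k::field \<Rightarrow> 'k \<Rightarrow> 'k \<Rightarrow> 'k \<Rightarrow> bool" where
  "admissible F p q f g \<longleftrightarrow>
     fst (x_params F p q) \<noteq> 0 \<and> fst (y_params F p q) \<noteq> 0 \<and>
     (\<exists>h \<in> ring_hom (R_alg F p q) (B_alg F p q f g).
        inj_on h (carrier (R_alg F p q)) \<and>
        (\<forall>c. h (quot_class (R_rels F p q) (scalar c)) = quot_class (B_rels F p q f g) (scalar c)) \<and>
        (\<forall>s. h (quot_class (R_rels F p q) (letter s)) = quot_class (B_rels F p q f g) (xv s)) \<and>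
        trimmed_double_extension (B_alg F p q f g)
          (\<lambda>c. quot_class (B_rels F p q f g) (scalar c))
          (h ` carrier (R_alg F p q))
          (\<lambda>i. quot_class (B_rels F p q f g) (yv i)))"


section \<open>Normal forms and structure coefficients\<close>

definition normal_word :: "nat \<Rightarrow> nat \<Rightarrow> nat \<Rightarrow> nat \<Rightarrow> gen fword" where
  "normal_word a b c d = Word (replicate a (Gen_x I1) @ replicate b (Gen_x I2) @
     replicate c (Gen_y I1) @ replicate d (Gen_y I2))"

definition normal_mono :: "nat \<Rightarrow> nat \<Rightarrow> nat \<Rightarrow> nat \<Rightarrow> (gen, 'k::field) free_alg" where
  "normal_mono a b c d = xv I1 ^ a * xv I2 ^ b * yv I1 ^ c * yv I2 ^ d"

text \<open>The expansion in the monomial basis is recorded as a linear combination of normal words in the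
  free algebra. It exists and is unique for admissible parameters; without that hypothesis the
  description need not denote.\<close>

definition NF :: "family \<Rightarrow> 'k::field \<Rightarrow> 'k \<Rightarrow> 'k \<Rightarrow> 'k \<Rightarrow> (gen, 'k) free_alg \<Rightarrow> (gen, 'k) free_alg" where
  "NF F p q f g w = (THE v.
     Poly_Mapping.keys v \<subseteq> {normal_word a b c d |a b c d. True} \<and>
     quot_class (B_rels F p q f g) v = quot_class (B_rels F p q f g) w)"

definition Theta :: "family \<Rightarrow> 'k::field \<Rightarrow> 'k \<Rightarrow> 'k \<Rightarrow> 'k \<Rightarrow>
    nat \<Rightarrow> nat \<Rightarrow> nat \<Rightarrow> nat \<Rightarrow> nat \<Rightarrow> nat \<Rightarrow> nat \<Rightarrow> nat \<Rightarrow> 'k" where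
  "Theta F p q f g a b c d \<alpha> \<beta> \<gamma> \<delta> =
     Poly_Mapping.lookup (NF F p q f g (yv I1 ^ c * yv I2 ^ d * xv I1 ^ a * xv I2 ^ b))
       (normal_word \<alpha> \<beta> \<gamma> \<delta>)"

definition q_int :: "'k::field \<Rightarrow> nat \<Rightarrow> 'k" where
  "q_int q n = (\<Sum>i<n. q ^ i)"

text \<open>The third equation is the recursion at $k = 0$, where the term with lower index $-1$
  vanishes; the vanishing for $k > n$ follows from the recursion.\<close>

fun q_binomial :: "'k::field \<Rightarrow> nat \<Rightarrow> nat \<Rightarrow> 'k" where
  "q_binomial q 0 0 = 1"
| "q_binomial q 0 (Suc k) = 0"
| "q_binomial q (Suc n) 0 = q_binomial q n 0"
| "q_binomial q (Suc n) (Suc k) = q_binomial q n k + q ^ Suc k * q_binomial q n (Suc k)"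

definition q_rising :: "'k::field \<Rightarrow> nat \<Rightarrow> nat \<Rightarrow> 'k" where
  "q_rising q m k = (\<Prod>j<k. q_int q (m + j))"

definition Lambda :: "'k::field \<times> 'k \<Rightarrow> nat \<Rightarrow> nat \<Rightarrow> nat \<Rightarrow> 'k" where
  "Lambda qr n m k = (case qr of (q, r) \<Rightarrow>
     if k > n then 0 else r ^ k * q ^ (m * (n - k)) * q_binomial q n k * q_rising q m k)"

definition kdelta :: "int \<Rightarrow> int \<Rightarrow> 'k::field" where
  "kdelta u v = (if u = v then 1 else 0)"

definition product_const_term :: "family \<Rightarrow> 'k::field \<Rightarrow> 'k \<Rightarrow> 'k \<Rightarrow> 'k \<Rightarrow>
    nat \<times> nat \<times> nat \<times> nat \<Rightarrow> nat \<times> nat \<times> nat \<times> nat \<Rightarrow> nat \<times> nat \<times> nat \<times> nat \<Rightarrow>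
    nat \<times> nat \<times> nat \<times> nat \<times> nat \<times> nat \<Rightarrow> 'k" where
  "product_const_term F p q f g =
     (\<lambda>(a, b, c, d) (a', b', c', d') (A, B, C, D) (\<alpha>, \<beta>, \<gamma>, \<delta>, r, s).
        Theta F p q f g a' b' c d \<alpha> \<beta> \<gamma> \<delta> *
        Lambda (x_params F p q) b \<alpha> r * Lambda (y_params F p q) \<delta> c' s *
        kdelta (int A) (int a + int \<alpha> + int r) * kdelta (int B) (int b - int r + int \<beta>) *
        kdelta (int C) (int \<gamma> + int c' + int s) * kdelta (int D) (int \<delta> - int s + int d'))"

text \<open>\<^const>\<open>Sum_any\<close> is the sum over all indices of a finitely supported function (and 0 if the
  support is infinite).\<close>

definition product_const :: "family \<Rightarrow> 'k::field \<Rightarrow> 'k \<Rightarrow> 'k \<Rightarrow> 'k \<Rightarrow>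
    nat \<times> nat \<times> nat \<times> nat \<Rightarrow> nat \<times> nat \<times> nat \<times> nat \<Rightarrow> nat \<times> nat \<times> nat \<times> nat \<Rightarrow> 'k" where
  "product_const F p q f g M N P = Sum_any (product_const_term F p q f g M N P)"

end

theory Submission
  imports Defs
begin

text \<open>Induction on $n$ turns $x_2x_1 = q x_1x_2 + r x_1^2$ into
  $x_2^n x_1^m = \sum_k \Lambda_{q,r}(n,m;k)\, x_1^{m+k} x_2^{n-k}$, and likewise for the $y$'s. In
  $MN = x_1^a x_2^b\,(y_1^c y_2^d x_1^{a'} x_2^{b'})\,y_1^{c'} y_2^{d'}$ one expands the middle factor
  by $\Theta$ and then reorders $x_2^b x_1^\alpha$ and $y_2^\delta y_1^{c'}$.
  Reading off coefficients needs the normal monomials to be a basis. They span because every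
  $y_i$ can be moved past the $x$'s. They are independent because $B$ is left free over
  the embedded plane $R$, whose monomials $x_1^a x_2^b$ are independent: $R$ acts on the functions
  on $\mathbb{N}^2$ by the formulas for left multiplication in this basis.\<close>

section \<open>Free algebras and their quotients\<close>

lemma poly_mapping_sum_single:
  "w = (\<Sum>u\<in>Poly_Mapping.keys w. Poly_Mapping.single u (Poly_Mapping.lookup w u))"
proof (rule poly_mapping_eqI)
  fix k
  show "Poly_Mapping.lookup w k = Poly_Mapping.lookup
      (\<Sum>u\<in>Poly_Mapping.keys w. Poly_Mapping.single u (Poly_Mapping.lookup w u)) k"
    by (simp add: lookup_sum lookup_single when_def in_keys_iff)
qed

text \<open>Every element is the finite sum of its single terms, so a claim preserved by sums need
  only be checked on those. The zero element occurs as a single term with coefficient 0.\<close>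

lemma poly_mapping_single_add_induct [case_names single add]:
  fixes w :: "'a \<Rightarrow>\<^sub>0 'b::comm_monoid_add"
  assumes single: "\<And>u c. P (Poly_Mapping.single u c)"
    and add: "\<And>v w. P v \<Longrightarrow> P w \<Longrightarrow> P (v + w)"
  shows "P w"
proof -
  have "P (\<Sum>u\<in>A. Poly_Mapping.single u (Poly_Mapping.lookup w u))" if "finite A" for A
    using that
  proof (induction A)
    case empty
    show ?case using single[of undefined 0] by simp
  next
    case (insert u A)
    then show ?case by (simp add: single add)
  qed
  then show ?thesis by (subst poly_mapping_sum_single) simp
qed

lemma scalar_commute: "scalar c * w = w * scalar c"
  by (induction w rule: poly_mapping_single_add_induct)
    (auto simp: scalar_def mult_single algebra_simps)

lemma scalar_left_commute: "w * (scalar c * v) = scalar c * (w * v)"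
  by (metis scalar_commute mult.assoc)

lemma scalar_0 [simp]: "scalar 0 = 0"
  by (simp add: scalar_def)

lemma scalar_1 [simp]: "scalar 1 = 1"
  by (simp add: scalar_def)

lemma scalar_add: "scalar (c + d) = scalar c + scalar d"
  by (simp add: scalar_def single_add)

lemma scalar_mult: "scalar (c * d) = scalar c * scalar d"
  by (simp add: scalar_def mult_single)

lemma scalar_scalar: "scalar c * (scalar d * w) = scalar (c * d) * w"
  by (simp add: scalar_mult mult.assoc)

lemma scalar_sum: "scalar (sum f A) = (\<Sum>i\<in>A. scalar (f i))"
  by (induction A rule: infinite_finite_induct) (simp_all add: scalar_add)

lemma ring_of_type_algebra_simps [simp]:
  "carrier ring_of_type_algebra = UNIV"
  "v \<otimes>\<^bsub>ring_of_type_algebra\<^esub> w = v * w"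
  "v \<oplus>\<^bsub>ring_of_type_algebra\<^esub> w = v + w"
  "\<one>\<^bsub>ring_of_type_algebra\<^esub> = 1"
  "\<zero>\<^bsub>ring_of_type_algebra\<^esub> = 0"
  by (simp_all add: ring_of_type_algebra_def)

text \<open>The library has this only for commutative rings.\<close>

lemma ring_ring_of_type_algebra: "ring (ring_of_type_algebra :: 'a::ring_1 ring)"
proof (rule ringI)
  show "abelian_group (ring_of_type_algebra :: 'a ring)"
    by (rule abelian_groupI)
      (auto simp: add.assoc add.commute intro: exI[of _ "- x" for x] left_minus)
  show "monoid (ring_of_type_algebra :: 'a ring)"
    by (rule monoidI) (simp_all add: mult.assoc)
qed (simp_all add: distrib_left distrib_right)

lemma ring_of_type_algebra_a_inv [simp]: "\<ominus>\<^bsub>ring_of_type_algebra\<^esub> v = - (v :: 'a::ring_1)"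
proof -
  interpret ring "ring_of_type_algebra :: 'a ring" by (rule ring_ring_of_type_algebra)
  show ?thesis
    by (rule minus_equality) simp_all
qed

section \<open>The quotient map and congruence modulo the relations\<close>

context
  fixes Rel :: "('g, 'k::field) free_alg set"
begin

lemma ideal_genideal: "ideal (genideal ring_of_type_algebra Rel) ring_of_type_algebra"
  by (rule ring.genideal_ideal[OF ring_ring_of_type_algebra]) simp

lemma quot_class_hom: "quot_class Rel \<in> ring_hom ring_of_type_algebra (presented_alg Rel)"
  using ideal.rcos_ring_hom[OF ideal_genideal]
  by (simp add: quot_class_def[abs_def] presented_alg_def)

lemma ring_presented_alg: "ring (presented_alg Rel)"
  unfolding presented_alg_def by (rule ideal.quotient_is_ring[OF ideal_genideal])

lemma quot_class_closed [simp]: "quot_class Rel v \<in> carrier (presented_alg Rel)"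
  using ring_hom_closed[OF quot_class_hom] by simp

lemma quot_class_add: "quot_class Rel (v + w) = quot_class Rel v \<oplus>\<^bsub>presented_alg Rel\<^esub> quot_class Rel w"
  using ring_hom_add[OF quot_class_hom] by simp

lemma quot_class_mult: "quot_class Rel (v * w) = quot_class Rel v \<otimes>\<^bsub>presented_alg Rel\<^esub> quot_class Rel w"
  using ring_hom_mult[OF quot_class_hom] by simp

lemma quot_class_1: "quot_class Rel 1 = \<one>\<^bsub>presented_alg Rel\<^esub>"
  using ring_hom_one[OF quot_class_hom] by simp

lemma quot_class_0: "quot_class Rel 0 = \<zero>\<^bsub>presented_alg Rel\<^esub>"
  using ring_hom_zero[OF quot_class_hom ring_ring_of_type_algebra ring_presented_alg] by simp

lemma quot_class_power: "quot_class Rel (v ^ n) = quot_class Rel v [^]\<^bsub>presented_alg Rel\<^esub> n"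
proof -
  interpret ring "presented_alg Rel" by (rule ring_presented_alg)
  show ?thesis
    by (induction n) (simp_all add: quot_class_1 quot_class_mult power_Suc2 del: power_Suc)
qed

lemma quot_class_sum:
  "quot_class Rel (sum f A) = finsum (presented_alg Rel) (\<lambda>i. quot_class Rel (f i)) A"
proof -
  interpret ring "presented_alg Rel" by (rule ring_presented_alg)
  show ?thesis
    by (induction A rule: infinite_finite_induct) (simp_all add: quot_class_0 quot_class_add)
qed

lemma quot_class_eq_0_iff:
  "quot_class Rel v = quot_class Rel 0 \<longleftrightarrow> v \<in> genideal ring_of_type_algebra Rel"
proof -
  interpret ideal "genideal ring_of_type_algebra Rel" "ring_of_type_algebra :: ('g, 'k) free_alg ring"
    by (rule ideal_genideal)
  have "genideal ring_of_type_algebra Rel +>\<^bsub>ring_of_type_algebra\<^esub> v =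
      genideal ring_of_type_algebra Rel \<longleftrightarrow> v \<in> genideal ring_of_type_algebra Rel"
    using a_rcos_self[of v] a_rcos_const[of v] by auto
  then show ?thesis
    unfolding quot_class_0 by (simp add: quot_class_def presented_alg_def FactRing_def)
qed

text \<open>With this rule and the next two, calculations in the quotient are carried out on
  representatives in the free algebra, where ordinary ring arithmetic applies; a relation is used by
  replacing one factor or summand inside \<open>quot_class\<close>.\<close>

lemma quot_class_add_cong:
  "quot_class Rel v = quot_class Rel v' \<Longrightarrow> quot_class Rel w = quot_class Rel w' \<Longrightarrow>
    quot_class Rel (v + w) = quot_class Rel (v' + w')"
  by (simp add: quot_class_add)

lemma quot_class_mult_cong:
  "quot_class Rel v = quot_class Rel v' \<Longrightarrow> quot_class Rel w = quot_class Rel w' \<Longrightarrow>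
    quot_class Rel (v * w) = quot_class Rel (v' * w')"
  by (simp add: quot_class_mult)

lemma quot_class_sum_cong:
  "(\<And>i. i \<in> A \<Longrightarrow> quot_class Rel (f i) = quot_class Rel (h i)) \<Longrightarrow>
    quot_class Rel (sum f A) = quot_class Rel (sum h A)"
  by (induction A rule: infinite_finite_induct) (simp_all add: quot_class_add)

lemma quot_class_eq_iff:
  "quot_class Rel v = quot_class Rel w \<longleftrightarrow> v - w \<in> genideal ring_of_type_algebra Rel"
proof
  assume "quot_class Rel v = quot_class Rel w"
  then have "quot_class Rel (v + - w) = quot_class Rel (w + - w)"
    by (rule quot_class_add_cong) simp
  then show "v - w \<in> genideal ring_of_type_algebra Rel"
    by (simp add: quot_class_eq_0_iff)
next
  assume "v - w \<in> genideal ring_of_type_algebra Rel"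
  then have "quot_class Rel (v - w + w) = quot_class Rel (0 + w)"
    by (intro quot_class_add_cong) (simp_all add: quot_class_eq_0_iff)
  then show "quot_class Rel v = quot_class Rel w" by simp
qed

lemma quot_class_relation:
  assumes "v - w \<in> Rel"
  shows "quot_class Rel v = quot_class Rel w"
  unfolding quot_class_eq_iff
  using assms ring.genideal_self[OF ring_ring_of_type_algebra, of Rel] by auto

end

section \<open>Reordering in a plane\<close>

lemma q_int_0 [simp]: "q_int q 0 = 0"
  by (simp add: q_int_def)

lemma q_int_Suc: "q_int q (Suc n) = 1 + q * q_int q n"
  unfolding q_int_def sum.lessThan_Suc_shift by (simp add: sum_distrib_left)

lemma q_binomial_eq_0: "n < k \<Longrightarrow> q_binomial q n k = 0"
  by (induction q n k rule: q_binomial.induct) auto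

lemma q_rising_Suc: "q_rising q m (Suc k) = q_rising q m k * q_int q (m + k)"
  by (simp add: q_rising_def)

lemma Lambda_eq_0: "n < k \<Longrightarrow> Lambda qr n m k = 0"
  by (simp add: Lambda_def split_beta)

lemma Lambda_0_0 [simp]: "Lambda qr 0 m 0 = 1"
  by (simp add: Lambda_def split_beta q_rising_def)

lemma Lambda_Suc_0: "Lambda (q, r) (Suc n) m 0 = q ^ m * Lambda (q, r) n m 0"
  by (simp add: Lambda_def q_rising_def power_add)

text \<open>The Pascal rule for the Gaussian binomial splits the left side: the summand with lower
  index \<open>k\<close> leaves over \<open>r\<close> and the last factor of the rising product, the
  other one leaves over \<open>q ^ Suc k\<close> and one more \<open>q ^ m\<close>.\<close>

lemma Lambda_Suc_Suc:
  "Lambda (q, r) (Suc n) m (Suc k) =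
    q ^ (m + Suc k) * Lambda (q, r) n m (Suc k) + r * q_int q (m + k) * Lambda (q, r) n m k"
proof (cases "k < n")
  case True
  \<comment> \<open>The additional \<open>q ^ m\<close> comes from this step between the exponents;
    with truncated subtraction it is valid only for \<open>k < n\<close>.\<close>
  then have "n - k = Suc (n - Suc k)" by simp
  with True show ?thesis
    by (simp add: Lambda_def q_rising_Suc power_add algebra_simps)
next
  case False
  then show ?thesis
    by (auto simp: Lambda_def q_rising_Suc q_binomial_eq_0)
qed

text \<open>Induction on \<open>m\<close>: exchanging \<open>z I2\<close> with one
  \<open>z I1\<close> yields a term with \<open>q\<close> and one with \<open>r\<close>, and the
  latter merges with the coefficient carried over from \<open>m\<close> because [m+1]_q = 1 + q
  [m]_q. The pair \<open>z\<close> is arbitrary so that the rule serves the x's and the y's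
  alike.\<close>

lemma mult_letter_power:
  fixes z :: "ind \<Rightarrow> ('g, 'k::field) free_alg"
  assumes "plane_relation z (q, r) \<in> Rel"
  shows "quot_class Rel (z I2 * z I1 ^ m) =
    quot_class Rel (scalar (q ^ m) * z I1 ^ m * z I2 + scalar (r * q_int q m) * z I1 ^ Suc m)"
proof (induction m)
  case 0
  show ?case by simp
next
  case (Suc m)
  have rel: "quot_class Rel (z I2 * z I1) = quot_class Rel (scalar q * z I1 * z I2 + scalar r * z I1 ^ 2)"
    using assms by (intro quot_class_relation) (simp add: plane_relation_def)
  have "quot_class Rel (z I2 * z I1 ^ Suc m) = quot_class Rel ((z I2 * z I1) * z I1 ^ m)"
    by (simp add: mult.assoc)
  also have "\<dots> = quot_class Rel ((scalar q * z I1 * z I2 + scalar r * z I1 ^ 2) * z I1 ^ m)"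
    by (intro quot_class_mult_cong rel refl)
  also have "\<dots> = quot_class Rel (scalar q * z I1 * (z I2 * z I1 ^ m) + scalar r * z I1 ^ Suc (Suc m))"
    by (simp add: algebra_simps power2_eq_square)
  also have "\<dots> = quot_class Rel (scalar q * z I1 *
      (scalar (q ^ m) * z I1 ^ m * z I2 + scalar (r * q_int q m) * z I1 ^ Suc m) +
      scalar r * z I1 ^ Suc (Suc m))"
    by (intro quot_class_mult_cong quot_class_add_cong Suc.IH refl)
  also have "scalar q * z I1 *
      (scalar (q ^ m) * z I1 ^ m * z I2 + scalar (r * q_int q m) * z I1 ^ Suc m) +
      scalar r * z I1 ^ Suc (Suc m) =
      scalar (q ^ Suc m) * z I1 ^ Suc m * z I2 + scalar (r * q_int q (Suc m)) * z I1 ^ Suc (Suc m)"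
    by (simp add: q_int_Suc scalar_add scalar_mult algebra_simps scalar_left_commute[of "z I1"])
  finally show ?case .
qed

text \<open>One more \<open>z I2\<close> on the left sends the term of index \<open>k\<close> to one
  of index \<open>k\<close> and one of index \<open>Suc k\<close>; collecting them gives exactly the
  recursion satisfied by \<open>Lambda\<close>.\<close>

lemma power_mult_letter_power:
  fixes z :: "ind \<Rightarrow> ('g, 'k::field) free_alg"
  assumes "plane_relation z qr \<in> Rel"
  shows "quot_class Rel (z I2 ^ n * z I1 ^ m) =
    quot_class Rel (\<Sum>k\<le>n. scalar (Lambda qr n m k) * z I1 ^ (m + k) * z I2 ^ (n - k))"
proof (induction n)
  case 0
  show ?case by simp
next
  case (Suc n)
  obtain q r where qr: "qr = (q, r)" by fastforce
  define L where "L = Lambda qr"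
  define M where "M i j = z I1 ^ i * z I2 ^ j" for i j
  have z2M: "quot_class Rel (z I2 * M i j) =
      quot_class Rel (scalar (q ^ i) * M i (Suc j) + scalar (r * q_int q i) * M (Suc i) j)" for i j
  proof -
    have "quot_class Rel ((z I2 * z I1 ^ i) * z I2 ^ j) =
      quot_class Rel ((scalar (q ^ i) * z I1 ^ i * z I2 + scalar (r * q_int q i) * z I1 ^ Suc i) * z I2 ^ j)"
      by (intro quot_class_mult_cong mult_letter_power refl) (use assms qr in simp)
    then show ?thesis by (simp add: M_def algebra_simps)
  qed
  have "quot_class Rel (z I2 ^ Suc n * z I1 ^ m) =
    quot_class Rel (z I2 * (\<Sum>k\<le>n. scalar (L n m k) * M (m + k) (n - k)))"
    unfolding power_Suc mult.assoc
    by (intro quot_class_mult_cong refl) (simp add: Suc.IH M_def L_def mult.assoc)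
  also have "z I2 * (\<Sum>k\<le>n. scalar (L n m k) * M (m + k) (n - k)) =
    (\<Sum>k\<le>n. scalar (L n m k) * (z I2 * M (m + k) (n - k)))"
    unfolding sum_distrib_left by (simp add: scalar_left_commute[of "z I2"])
  also have "quot_class Rel \<dots> = quot_class Rel (\<Sum>k\<le>n. scalar (L n m k) *
      (scalar (q ^ (m + k)) * M (m + k) (Suc (n - k)) + scalar (r * q_int q (m + k)) * M (Suc (m + k)) (n - k)))"
    by (intro quot_class_sum_cong quot_class_mult_cong z2M refl)
  also have "(\<Sum>k\<le>n. scalar (L n m k) *
      (scalar (q ^ (m + k)) * M (m + k) (Suc (n - k)) + scalar (r * q_int q (m + k)) * M (Suc (m + k)) (n - k))) =
    (\<Sum>k\<le>n. scalar (q ^ (m + k) * L n m k) * M (m + k) (Suc n - k)) +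
    (\<Sum>k\<le>n. scalar (r * q_int q (m + k) * L n m k) * M (m + Suc k) (Suc n - Suc k))"
    unfolding sum.distrib[symmetric]
    by (intro sum.cong refl)
      (simp add: Suc_diff_le scalar_scalar distrib_left mult.commute mult.left_commute)
  \<comment> \<open>The index \<open>Suc n\<close> may be added since \<open>Lambda\<close> vanishes
    there. Splitting off index 0 then aligns this sum with the shifted second one.\<close>
  also have "(\<Sum>k\<le>n. scalar (q ^ (m + k) * L n m k) * M (m + k) (Suc n - k)) =
    (\<Sum>k\<le>Suc n. scalar (q ^ (m + k) * L n m k) * M (m + k) (Suc n - k))"
    by (simp add: L_def Lambda_eq_0)
  also have "\<dots> + (\<Sum>k\<le>n. scalar (r * q_int q (m + k) * L n m k) * M (m + Suc k) (Suc n - Suc k)) =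
    (\<Sum>k\<le>Suc n. scalar (L (Suc n) m k) * M (m + k) (Suc n - k))"
    unfolding sum.atMost_Suc_shift
    by (simp add: L_def qr Lambda_Suc_0 Lambda_Suc_Suc scalar_add distrib_right sum.distrib add.assoc)
  finally show ?case by (simp only: M_def L_def mult.assoc)
qed

section \<open>The plane acts on functions\<close>

text \<open>\<open>foldr\<close> applies the operator of the last letter first, so concatenation of
  words becomes composition and a left action results.\<close>

definition letter_act ::
    "('g \<Rightarrow> ('i \<Rightarrow> 'k::field) \<Rightarrow> 'i \<Rightarrow> 'k) \<Rightarrow> 'g fword \<Rightarrow> ('i \<Rightarrow> 'k) \<Rightarrow> 'i \<Rightarrow> 'k" where
  "letter_act L u = (case u of Word l \<Rightarrow> foldr L l)"

definition free_alg_act ::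
    "('g \<Rightarrow> ('i \<Rightarrow> 'k::field) \<Rightarrow> 'i \<Rightarrow> 'k) \<Rightarrow> ('g, 'k) free_alg \<Rightarrow> ('i \<Rightarrow> 'k) \<Rightarrow> 'i \<Rightarrow> 'k" where
  "free_alg_act L w \<phi> i =
    (\<Sum>u\<in>Poly_Mapping.keys w. Poly_Mapping.lookup w u * letter_act L u \<phi> i)"

lemma letter_act_0 [simp]: "letter_act L 0 \<phi> = \<phi>"
  by (simp add: letter_act_def zero_fword_def)

lemma letter_act_add: "letter_act L (u + v) \<phi> = letter_act L u (letter_act L v \<phi>)"
  by (cases u; cases v) (simp add: letter_act_def)

lemma free_alg_act_superset:
  "finite U \<Longrightarrow> Poly_Mapping.keys w \<subseteq> U \<Longrightarrow>
    free_alg_act L w \<phi> i = (\<Sum>u\<in>U. Poly_Mapping.lookup w u * letter_act L u \<phi> i)"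
  unfolding free_alg_act_def by (rule sum.mono_neutral_left) (auto simp: in_keys_iff)

lemma free_alg_act_0 [simp]: "free_alg_act L 0 \<phi> i = 0"
  by (simp add: free_alg_act_def)

lemma free_alg_act_add: "free_alg_act L (v + w) \<phi> i = free_alg_act L v \<phi> i + free_alg_act L w \<phi> i"
proof -
  let ?U = "Poly_Mapping.keys v \<union> Poly_Mapping.keys w"
  have "Poly_Mapping.keys (v + w) \<subseteq> ?U" by (rule keys_add)
  then show ?thesis
    by (simp add: free_alg_act_superset[of ?U] lookup_add distrib_right sum.distrib)
qed

lemma free_alg_act_single: "free_alg_act L (Poly_Mapping.single u c) \<phi> i = c * letter_act L u \<phi> i"
  by (simp add: free_alg_act_def)

lemma free_alg_act_uminus: "free_alg_act L (- w) \<phi> i = - free_alg_act L w \<phi> i"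
  using free_alg_act_add[of L w "- w" \<phi> i] by (simp add: eq_neg_iff_add_eq_0 add.commute)

lemma free_alg_act_scalar: "free_alg_act L (scalar c) \<phi> i = c * \<phi> i"
  by (simp add: scalar_def free_alg_act_single)

lemma free_alg_act_1 [simp]: "free_alg_act L 1 \<phi> i = \<phi> i"
  using free_alg_act_scalar[of L 1] by simp

lemma free_alg_act_letter: "free_alg_act L (letter s) \<phi> = L s \<phi>"
  by (rule ext) (simp add: letter_def free_alg_act_single letter_act_def)

lemma free_alg_act_sum: "free_alg_act L (sum f A) \<phi> i = (\<Sum>j\<in>A. free_alg_act L (f j) \<phi> i)"
  by (induction A rule: infinite_finite_induct) (simp_all add: free_alg_act_add)

context
  fixes L :: "'g \<Rightarrow> ('i \<Rightarrow> 'k::field) \<Rightarrow> 'i \<Rightarrow> 'k"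
  assumes L_add: "\<And>s \<phi> \<psi>. L s (\<lambda>i. \<phi> i + \<psi> i) = (\<lambda>i. L s \<phi> i + L s \<psi> i)"
    and L_scale: "\<And>s c \<phi>. L s (\<lambda>i. c * \<phi> i) = (\<lambda>i. c * L s \<phi> i)"
begin

lemma letter_act_linear:
  "letter_act L u (\<lambda>i. \<phi> i + \<psi> i) = (\<lambda>i. letter_act L u \<phi> i + letter_act L u \<psi> i)"
  "letter_act L u (\<lambda>i. c * \<phi> i) = (\<lambda>i. c * letter_act L u \<phi> i)"
proof -
  obtain l where u: "u = Word l" by (cases u)
  show "letter_act L u (\<lambda>i. \<phi> i + \<psi> i) = (\<lambda>i. letter_act L u \<phi> i + letter_act L u \<psi> i)"
    unfolding u letter_act_def by (induction l) (simp_all add: L_add)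
  show "letter_act L u (\<lambda>i. c * \<phi> i) = (\<lambda>i. c * letter_act L u \<phi> i)"
    unfolding u letter_act_def by (induction l) (simp_all add: L_scale)
qed

lemma free_alg_act_linear:
  "free_alg_act L w (\<lambda>i. \<phi> i + \<psi> i) i = free_alg_act L w \<phi> i + free_alg_act L w \<psi> i"
  by (simp add: free_alg_act_def letter_act_linear distrib_left sum.distrib)

text \<open>Linearity of the letter operators makes both sides additive in each factor, which leaves
  products of single words, where concatenation is composition.\<close>

lemma free_alg_act_mult: "free_alg_act L (v * w) \<phi> = free_alg_act L v (free_alg_act L w \<phi>)"
proof (induction v rule: poly_mapping_single_add_induct)
  case (single u c)
  show ?case
  proof (induction w rule: poly_mapping_single_add_induct)
    case (single u' c')
    show ?case
      by (rule ext, simp add: mult_single free_alg_act_single letter_act_add)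
        (simp add: free_alg_act_single[abs_def] letter_act_linear)
  next
    case (add v w)
    show ?case
      by (rule ext) (simp add: distrib_left free_alg_act_add add free_alg_act_linear
          free_alg_act_add[abs_def])
  qed
next
  case (add v v')
  then show ?case
    by (intro ext) (simp add: distrib_right free_alg_act_add)
qed

text \<open>The elements acting as zero form a two-sided ideal \<open>J\<close>, which contains the
  generated ideal once it contains the relations. Hence an element with nonzero action has a nonzero
  class.\<close>

lemma free_alg_act_genideal:
  assumes Rel: "\<And>w \<phi> i. w \<in> Rel \<Longrightarrow> free_alg_act L w \<phi> i = 0"
    and w: "w \<in> genideal ring_of_type_algebra Rel"
  shows "free_alg_act L w \<phi> i = 0"
proof -
  define J where "J = {w. \<forall>\<phi> i. free_alg_act L w \<phi> i = 0}"
  \<comment> \<open>Scaling by 0 shows that every element kills the zero function; closure of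
    \<open>J\<close> under left multiplication rests on this.\<close>
  have act_zero: "free_alg_act L v \<phi> j = 0" if "\<And>i. \<phi> i = 0" for v \<phi> j
  proof -
    have "\<phi> = (\<lambda>i. 0)" using that by auto
    then show ?thesis
      using letter_act_linear(2)[of _ 0 "\<lambda>_. 0"] by (simp add: free_alg_act_def)
  qed
  interpret ring "ring_of_type_algebra :: ('g, 'k) free_alg ring" by (rule ring_ring_of_type_algebra)
  have "ideal J ring_of_type_algebra"
  proof (rule idealI)
    show "subgroup J (add_monoid ring_of_type_algebra)"
    proof (rule add.subgroupI)
      show "J \<noteq> {}" by (auto simp: J_def intro!: exI[of _ 0])
    qed (auto simp: J_def free_alg_act_add free_alg_act_uminus a_inv_def[symmetric])
  qed (auto simp: J_def free_alg_act_mult act_zero ring_axioms)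
  then have "genideal ring_of_type_algebra Rel \<subseteq> J"
    by (rule genideal_minimal) (auto simp: J_def Rel)
  with w show ?thesis by (auto simp: J_def)
qed

end

text \<open>A function \<phi> stands for the formal sum of the terms \<phi>(a,b) x_1^a x_2^b. The
  two operators are left multiplication by x_1 and x_2 in these coordinates, read off from x_2 x_1^a
  = q^a x_1^a x_2 + r [a]_q x_1^(a+1). Being explicit formulas, they presuppose no independence of
  the monomials.\<close>

primrec plane_act :: "'k::field \<times> 'k \<Rightarrow> ind \<Rightarrow> (nat \<times> nat \<Rightarrow> 'k) \<Rightarrow> nat \<times> nat \<Rightarrow> 'k" where
  "plane_act qr I1 = (\<lambda>\<phi> (a, b). case a of 0 \<Rightarrow> 0 | Suc a' \<Rightarrow> \<phi> (a', b))"
| "plane_act qr I2 = (\<lambda>\<phi> (a, b).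
     (case b of 0 \<Rightarrow> 0 | Suc b' \<Rightarrow> fst qr ^ a * \<phi> (a, b')) +
     (case a of 0 \<Rightarrow> 0 | Suc a' \<Rightarrow> snd qr * q_int (fst qr) a' * \<phi> (a', b)))"

lemma plane_act_linear:
  "plane_act qr s (\<lambda>i. \<phi> i + \<psi> i) = (\<lambda>i. plane_act qr s \<phi> i + plane_act qr s \<psi> i)"
  "plane_act qr s (\<lambda>i. c * \<phi> i) = (\<lambda>i. c * plane_act qr s \<phi> i)"
  by (cases s; auto simp: fun_eq_iff algebra_simps split: nat.splits)+

lemmas plane_free_alg_act_mult = free_alg_act_mult[of "plane_act qr" for qr, OF plane_act_linear]

text \<open>The terms with \<open>q\<close> cancel directly; those with \<open>r\<close> cancel by
  [a+1]_q = 1 + q [a]_q.\<close>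

lemma free_alg_act_plane_relation:
  "free_alg_act (plane_act qr) (plane_relation letter qr) \<phi> i = 0"
proof -
  obtain q r where qr: "qr = (q, r)" by fastforce
  obtain a b where i: "i = (a, b)" by fastforce
  have "free_alg_act (plane_act qr) (plane_relation letter qr) \<phi> i =
    plane_act qr I2 (plane_act qr I1 \<phi>) i -
      (q * plane_act qr I1 (plane_act qr I2 \<phi>) i + r * plane_act qr I1 (plane_act qr I1 \<phi>) i)"
    unfolding plane_relation_def diff_conv_add_uminus free_alg_act_add free_alg_act_uminus
        power2_eq_square mult.assoc plane_free_alg_act_mult free_alg_act_letter free_alg_act_scalar
    by (simp add: qr)
  also have "\<dots> = 0"
    by (auto simp: qr i q_int_Suc algebra_simps split: nat.splits)
  finally show ?thesis .
qed

definition delta :: "'i \<Rightarrow> 'i \<Rightarrow> 'k::field" where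
  "delta j i = (if i = j then 1 else 0)"

text \<open>On the column with first index 0 the factor q^0 is 1 and [0]_q is 0, so x_2 acts there
  as a pure shift.\<close>

lemma plane_act_delta:
  "plane_act qr I1 (delta (a, b)) = delta (Suc a, b)"
  "plane_act qr I2 (delta (0, b)) = delta (0, Suc b)"
proof -
  show "plane_act qr I1 (delta (a, b)) = delta (Suc a, b)"
    by (rule ext) (simp add: delta_def split_beta prod_eq_iff split: nat.split)
  show "plane_act qr I2 (delta (0, b)) = delta (0, Suc b)"
    by (rule ext) (simp add: delta_def split_beta prod_eq_iff split: nat.split)
qed

text \<open>The powers of x_2 act first, climbing the column with first index 0; the powers of x_1
  then raise the first index. Distinct monomials thus send the unit \<open>delta (0, 0)\<close> to
  distinct point masses.\<close>

lemma plane_monomial_act: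
  "free_alg_act (plane_act qr) (letter I1 ^ a * letter I2 ^ b) (delta (0, 0)) = delta (a, b)"
proof -
  have b: "free_alg_act (plane_act qr) (letter I2 ^ b) (delta (0, 0)) = delta (0, b)"
  proof (induction b)
    case 0
    show ?case by (rule ext) simp
  next
    case (Suc b)
    show ?case
      by (simp only: power_Suc plane_free_alg_act_mult
          Suc.IH free_alg_act_letter plane_act_delta)
  qed
  show ?thesis
  proof (induction a)
    case 0
    show ?case by (simp add: b)
  next
    case (Suc a)
    show ?case
      by (simp only: power_Suc mult.assoc plane_free_alg_act_mult[of _ "letter I1"]
          Suc.IH free_alg_act_letter plane_act_delta)
  qed
qed

text \<open>A combination in the ideal acts as zero, yet applied to \<open>delta (0, 0)\<close> it
  returns its own coefficients.\<close>

lemma plane_monomials_independent: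
  fixes \<kappa> :: "nat \<Rightarrow> nat \<Rightarrow> 'k::field"
  assumes fin: "finite J"
    and zero: "quot_class {plane_relation letter qr}
      (\<Sum>(a, b)\<in>J. scalar (\<kappa> a b) * (letter I1 ^ a * letter I2 ^ b)) =
      quot_class {plane_relation letter qr} 0"
    and ab: "(a, b) \<in> J"
  shows "\<kappa> a b = 0"
proof -
  let ?e = "delta (0, 0) :: nat \<times> nat \<Rightarrow> 'k"
  let ?\<rho> = "\<Sum>(a, b)\<in>J. scalar (\<kappa> a b) * (letter I1 ^ a * letter I2 ^ b)"
  have "free_alg_act (plane_act qr) ?\<rho> ?e (a, b) = 0"
    by (rule free_alg_act_genideal[OF plane_act_linear, where Rel = "{plane_relation letter qr}"])
      (use zero in \<open>auto simp: free_alg_act_plane_relation quot_class_eq_0_iff\<close>)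
  moreover have "free_alg_act (plane_act qr) ?\<rho> ?e (a, b) =
    (\<Sum>j\<in>J. if (a, b) = j then \<kappa> a b else 0)"
    unfolding free_alg_act_sum
    by (intro sum.cong refl)
      (auto simp: plane_free_alg_act_mult[of _ "scalar _"] free_alg_act_scalar plane_monomial_act delta_def split: if_splits)
  ultimately show ?thesis using fin ab by simp
qed

section \<open>Normal forms\<close>

lemma letter_power: "letter s ^ n = Poly_Mapping.single (Word (replicate n s)) 1"
  by (induction n)
    (simp_all add: letter_def mult_single zero_fword_def[symmetric])

lemma normal_mono_eq_single: "normal_mono a b c d = Poly_Mapping.single (normal_word a b c d) 1"
  by (simp add: normal_mono_def normal_word_def letter_power mult_single)

text \<open>The exponents can be recovered by counting the occurrences of each of the four
  letters.\<close>

lemma normal_word_eq_iff [simp]: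
  "normal_word a b c d = normal_word a' b' c' d' \<longleftrightarrow> a = a' \<and> b = b' \<and> c = c' \<and> d = d'"
proof
  assume "normal_word a b c d = normal_word a' b' c' d'"
  then have "count_list (replicate a (Gen_x I1) @ replicate b (Gen_x I2) @
      replicate c (Gen_y I1) @ replicate d (Gen_y I2)) s =
    count_list (replicate a' (Gen_x I1) @ replicate b' (Gen_x I2) @
      replicate c' (Gen_y I1) @ replicate d' (Gen_y I2)) s" for s
    by (simp add: normal_word_def)
  moreover have "count_list (replicate n t) s = (if s = t then n else 0)" for n and s t :: gen
    by (induction n) auto
  ultimately have "(if s = Gen_x I1 then a else 0) + ((if s = Gen_x I2 then b else 0) +
      ((if s = Gen_y I1 then c else 0) + (if s = Gen_y I2 then d else 0))) =
    (if s = Gen_x I1 then a' else 0) + ((if s = Gen_x I2 then b' else 0) +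
      ((if s = Gen_y I1 then c' else 0) + (if s = Gen_y I2 then d' else 0)))" for s
    by simp
  from this[of "Gen_x I1"] this[of "Gen_x I2"] this[of "Gen_y I1"] this[of "Gen_y I2"]
  show "a = a' \<and> b = b' \<and> c = c' \<and> d = d'" by simp
qed simp

abbreviation normal_words :: "gen fword set" where
  "normal_words \<equiv> {normal_word a b c d |a b c d. True}"

text \<open>\<open>T\<close> may be any finite set containing the support: independence uses a box
  of exponents, the expansion of \<open>NF\<close> the exact support.\<close>

lemma normal_expansion:
  assumes keys: "Poly_Mapping.keys v \<subseteq> normal_words"
    and T: "finite T" "\<And>a b c d. Poly_Mapping.lookup v (normal_word a b c d) \<noteq> 0 \<Longrightarrow> (a, b, c, d) \<in> T"
  shows "v = (\<Sum>(a, b, c, d)\<in>T.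
    scalar (Poly_Mapping.lookup v (normal_word a b c d)) * normal_mono a b c d)"
proof (rule poly_mapping_eqI)
  fix k
  show "Poly_Mapping.lookup v k = Poly_Mapping.lookup (\<Sum>(a, b, c, d)\<in>T.
    scalar (Poly_Mapping.lookup v (normal_word a b c d)) * normal_mono a b c d) k" (is "_ = ?R")
  proof (cases "k \<in> normal_words")
    case True
    then obtain a b c d where k: "k = normal_word a b c d" by blast
    have "?R = (\<Sum>t\<in>T. if t = (a, b, c, d) then Poly_Mapping.lookup v k else 0)"
      unfolding lookup_sum
      by (rule sum.cong) (auto simp: k scalar_def normal_mono_eq_single mult_single lookup_single when_def split: if_splits)
    also have "\<dots> = Poly_Mapping.lookup v k"
      using T by (auto simp: k)
    finally show ?thesis by simp
  next
    case False
    then have "Poly_Mapping.lookup v k = 0"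
      using keys by (meson in_keys_iff subsetD)
    moreover have "?R = 0"
      unfolding lookup_sum
      by (rule sum.neutral)
        (use False in \<open>auto simp: scalar_def normal_mono_eq_single mult_single lookup_single when_def\<close>)
    ultimately show ?thesis by simp
  qed
qed

lemma finite_normal_support:
  "finite {(a, b, c, d). Poly_Mapping.lookup v (normal_word a b c d) \<noteq> 0}"
proof (rule finite_subset)
  let ?f = "\<lambda>(a, b, c, d). normal_word a b c d"
  show "{(a, b, c, d). Poly_Mapping.lookup v (normal_word a b c d) \<noteq> 0} \<subseteq> ?f -` Poly_Mapping.keys v"
    by (auto simp: in_keys_iff)
  show "finite (?f -` Poly_Mapping.keys v)"
    by (rule finite_vimageI) (auto simp: inj_def)
qed

text \<open>The preimage in the free algebra of the linear span of the classes of \<open>M\<close>.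
  The rule \<open>eq\<close> builds in the change of representative, so closure properties follow by
  rule induction without a vector space structure on the quotient.\<close>

inductive_set mod_span :: "('g, 'k::field) free_alg set \<Rightarrow> ('g, 'k) free_alg set \<Rightarrow> ('g, 'k) free_alg set"
  for Rel M where
  zero: "0 \<in> mod_span Rel M"
| add: "m \<in> M \<Longrightarrow> v \<in> mod_span Rel M \<Longrightarrow> scalar c * m + v \<in> mod_span Rel M"
| eq: "v \<in> mod_span Rel M \<Longrightarrow> quot_class Rel v = quot_class Rel w \<Longrightarrow> w \<in> mod_span Rel M"

lemma mod_span_add: "v \<in> mod_span Rel M \<Longrightarrow> w \<in> mod_span Rel M \<Longrightarrow> v + w \<in> mod_span Rel M"
proof (induction v rule: mod_span.induct)
  case zero
  then show ?case by simp
next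
  case (add m v c)
  then show ?case by (simp add: add.assoc mod_span.add)
next
  case (eq v v')
  show ?case
    by (rule mod_span.eq[OF eq.IH[OF eq.prems]]) (intro quot_class_add_cong eq.hyps refl)
qed

lemma mod_span_scalar: "v \<in> mod_span Rel M \<Longrightarrow> scalar c * v \<in> mod_span Rel M"
proof (induction v rule: mod_span.induct)
  case zero
  show ?case by (simp add: mod_span.zero)
next
  case (add m v d)
  then show ?case by (simp add: distrib_left scalar_scalar mod_span.add)
next
  case (eq v v')
  show ?case
    by (rule mod_span.eq[OF eq.IH]) (intro quot_class_mult_cong eq.hyps refl)
qed

lemma mod_span_base: "m \<in> M \<Longrightarrow> m \<in> mod_span Rel M"
  using mod_span.add[OF _ mod_span.zero, of m M 1 Rel] by simp

lemma mod_span_sum: "(\<And>i. i \<in> A \<Longrightarrow> f i \<in> mod_span Rel M) \<Longrightarrow> sum f A \<in> mod_span Rel M"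
  by (induction A rule: infinite_finite_induct) (auto simp: mod_span.zero mod_span_add)

text \<open>Left multiplication is linear and respects classes, so stability of a span under it is
  decided on the generators.\<close>

lemma mod_span_mult:
  assumes "\<And>m. m \<in> M \<Longrightarrow> u * m \<in> mod_span Rel M" and "v \<in> mod_span Rel M"
  shows "u * v \<in> mod_span Rel M"
  using assms(2)
proof (induction v rule: mod_span.induct)
  case zero
  show ?case by (simp add: mod_span.zero)
next
  case (add m v c)
  then show ?case
    by (simp add: distrib_left scalar_left_commute mod_span_add mod_span_scalar assms(1))
next
  case (eq v v')
  show ?case
    by (rule mod_span.eq[OF eq.IH]) (intro quot_class_mult_cong eq.hyps refl)
qed

text \<open>Grouped by y-monomials, \<open>v\<close> becomes a combination of the left basis with
  coefficients that are polynomials in the x's. Left freeness makes these vanish in the image of the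
  plane, injectivity of \<open>h\<close> pulls this back to the plane, and there the monomials are
  independent.\<close>

lemma normal_form_unique_0:
  fixes v :: "(gen, 'k::field) free_alg"
  assumes adm: "admissible F p q f g"
    and keys: "Poly_Mapping.keys v \<subseteq> normal_words"
    and v0: "quot_class (B_rels F p q f g) v = quot_class (B_rels F p q f g) 0"
  shows "v = 0"
proof -
  let ?R = "presented_alg (R_rels F p q)" and ?B = "presented_alg (B_rels F p q f g)"
  let ?r = "quot_class (R_rels F p q)" and ?b = "quot_class (B_rels F p q f g)"
  obtain h where h: "h \<in> ring_hom ?R ?B" and inj: "inj_on h (carrier ?R)"
    and h_scalar: "\<And>c. h (?r (scalar c)) = ?b (scalar c)"
    and h_letter: "\<And>s. h (?r (letter s)) = ?b (xv s)"
    and ext: "trimmed_double_extension ?B (\<lambda>c. ?b (scalar c)) (h ` carrier ?R) (\<lambda>i. ?b (yv i))"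
    using adm by (auto simp: admissible_def R_alg_def B_alg_def)
  interpret trimmed_double_extension ?B "\<lambda>c. ?b (scalar c)" "h ` carrier ?R" "\<lambda>i. ?b (yv i)"
    by (rule ext)
  \<comment> \<open>Starting from scalars and letters, these rules identify the image under
    \<open>h\<close> of each polynomial in the plane with the same polynomial in the x's.\<close>
  have h_add: "h (?r (u + w)) = ?b (u' + w')" if "h (?r u) = ?b u'" "h (?r w) = ?b w'" for u w u' w'
    using that ring_hom_add[OF h] by (simp add: quot_class_add)
  have h_mult: "h (?r (u * w)) = ?b (u' * w')" if "h (?r u) = ?b u'" "h (?r w) = ?b w'" for u w u' w'
    using that ring_hom_mult[OF h] by (simp add: quot_class_mult)
  have h_1: "h (?r 1) = ?b 1" and h_0: "h (?r 0) = ?b 0"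
    using h_scalar[of 1] h_scalar[of 0] by simp_all
  have h_power: "h (?r (letter s ^ n)) = ?b (xv s ^ n)" for s n
    by (induction n) (auto simp: h_1 intro!: h_mult h_letter)
  have h_sum: "h (?r (sum u A)) = ?b (sum u' A)"
    if "\<And>i. i \<in> A \<Longrightarrow> h (?r (u i)) = ?b (u' i)"
    for A :: "(nat \<times> nat) set" and u u'
    using that by (induction A rule: infinite_finite_induct) (auto simp: h_0 intro!: h_add)

  define \<kappa> where "\<kappa> = (\<lambda>(c, d) a b. Poly_Mapping.lookup v (normal_word a b c d))"
  let ?sum = "\<lambda>(a, b, c, d). a + b + c + d :: nat"
  have "finite (?sum ` {(a, b, c, d). Poly_Mapping.lookup v (normal_word a b c d) \<noteq> 0})"
    by (intro finite_imageI finite_normal_support)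
  \<comment> \<open>A strict bound on the total degree over the finite support bounds each exponent,
    so one square \<open>Box\<close> serves both the x-exponents and the y-exponents.\<close>
  then obtain N where N: "?sum ` {(a, b, c, d). Poly_Mapping.lookup v (normal_word a b c d) \<noteq> 0} \<subseteq> {..<N}"
    unfolding finite_nat_iff_bounded by blast
  have bound: "a < N \<and> b < N \<and> c < N \<and> d < N"
    if "Poly_Mapping.lookup v (normal_word a b c d) \<noteq> 0" for a b c d
  proof -
    have "?sum (a, b, c, d) \<in> {..<N}"
      using that by (intro subsetD[OF N] imageI) simp
    then show ?thesis by simp
  qed
  define Box where "Box = {..<N} \<times> {..<N}"
  have Box: "finite Box" by (simp add: Box_def)
  define \<rho> where "\<rho> k = (\<Sum>(a, b)\<in>Box. scalar (\<kappa> k a b) * (letter I1 ^ a * letter I2 ^ b))" for k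
  define \<rho>' where "\<rho>' k = (\<Sum>(a, b)\<in>Box. scalar (\<kappa> k a b) * (xv I1 ^ a * xv I2 ^ b))" for k
  define Y :: "nat \<times> nat \<Rightarrow> (gen, 'k) free_alg" where "Y = (\<lambda>(c, d). yv I1 ^ c * yv I2 ^ d)"
  have h_\<rho>: "h (?r (\<rho> k)) = ?b (\<rho>' k)" for k
    unfolding \<rho>_def \<rho>'_def by (rule h_sum) (auto intro!: h_mult h_scalar h_power)
  have \<rho>_outside: "\<rho> k = 0" if "k \<notin> Box" for k
  proof -
    have "\<kappa> k a b = 0" for a b
      using that bound[of a b "fst k" "snd k"] by (cases k) (auto simp: Box_def \<kappa>_def)
    then show ?thesis by (simp add: \<rho>_def)
  qed
  \<comment> \<open>The box is indexed with the y-exponents first, so that the sum can be grouped by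
    y-monomials.\<close>
  have "v = (\<Sum>(a, b, c, d)\<in>(\<lambda>((c, d), (a, b)). (a, b, c, d)) ` (Box \<times> Box).
      scalar (Poly_Mapping.lookup v (normal_word a b c d)) * normal_mono a b c d)"
  proof (rule normal_expansion[OF keys])
    fix a b c d
    assume "Poly_Mapping.lookup v (normal_word a b c d) \<noteq> 0"
    from bound[OF this] show "(a, b, c, d) \<in> (\<lambda>((c, d), (a, b)). (a, b, c, d)) ` (Box \<times> Box)"
      by (intro image_eqI[of _ _ "((c, d), (a, b))"]) (simp_all add: Box_def)
  qed (simp add: Box)
  also have "\<dots> = (\<Sum>k\<in>Box. \<rho>' k * Y k)"
    unfolding \<rho>'_def sum_distrib_right sum.cartesian_product
    by (subst sum.reindex)
      (auto simp: inj_on_def Y_def \<kappa>_def normal_mono_def mult.assoc intro!: sum.cong)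
  finally have v: "v = (\<Sum>k\<in>Box. \<rho>' k * Y k)" .

  define m where "m = (\<lambda>(i::nat, j::nat). ?b (yv I1) [^]\<^bsub>?B\<^esub> i \<otimes>\<^bsub>?B\<^esub> ?b (yv I2) [^]\<^bsub>?B\<^esub> j)"
  have Y: "?b (Y k) = m k" for k
    by (cases k) (simp add: Y_def m_def quot_class_mult quot_class_power)
  define \<gamma> where "\<gamma> k = h (?r (\<rho> k))" for k
  have \<gamma>_closed: "\<gamma> k \<in> carrier ?B" for k
    using ring_hom_closed[OF h] by (simp add: \<gamma>_def)
  have m_closed: "m k \<in> carrier ?B" for k
    using quot_class_closed by (simp flip: Y)
  have support: "{k. \<gamma> k \<noteq> \<zero>\<^bsub>?B\<^esub>} \<subseteq> Box"
    using \<rho>_outside h_0 by (auto simp: \<gamma>_def quot_class_0)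
  have "?b v = (\<Oplus>\<^bsub>?B\<^esub>k\<in>Box. \<gamma> k \<otimes>\<^bsub>?B\<^esub> m k)"
    by (simp add: v quot_class_sum quot_class_mult Y \<gamma>_def h_\<rho>)
  also have "\<dots> = (\<Oplus>\<^bsub>?B\<^esub>k\<in>{k. \<gamma> k \<noteq> \<zero>\<^bsub>?B\<^esub>}. \<gamma> k \<otimes>\<^bsub>?B\<^esub> m k)"
    by (rule add.finprod_mono_neutral_cong_right[OF Box support])
      (auto simp: \<gamma>_closed m_closed)
  finally have \<gamma>_sum: "\<zero>\<^bsub>?B\<^esub> = (\<Oplus>\<^bsub>?B\<^esub>k\<in>{k. \<gamma> k \<noteq> \<zero>\<^bsub>?B\<^esub>}. \<gamma> k \<otimes>\<^bsub>?B\<^esub> m k)"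
    unfolding v0 quot_class_0 .
  \<comment> \<open>Uniqueness of coefficients is applied to the zero element, which both \<gamma>
    and the zero family represent.\<close>
  define coeffs where "coeffs c \<longleftrightarrow> range c \<subseteq> h ` carrier ?R \<and> finite {k. c k \<noteq> \<zero>\<^bsub>?B\<^esub>} \<and>
      \<zero>\<^bsub>?B\<^esub> = (\<Oplus>\<^bsub>?B\<^esub>k\<in>{k. c k \<noteq> \<zero>\<^bsub>?B\<^esub>}. c k \<otimes>\<^bsub>?B\<^esub> m k)" for c
  have "\<exists>!c. coeffs c"
    unfolding coeffs_def
    by (rule bspec[OF conjunct2[OF left_free[unfolded left_basis_def m_def[symmetric]]] zero_closed])
  moreover have "range \<gamma> \<subseteq> h ` carrier ?R"
    by (simp add: \<gamma>_def image_subset_iff)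
  then have "coeffs \<gamma>"
    unfolding coeffs_def by (rule conjI[OF _ conjI[OF finite_subset[OF support Box] \<gamma>_sum]])
  moreover have "coeffs (\<lambda>_. \<zero>\<^bsub>?B\<^esub>)"
  proof -
    have "\<zero>\<^bsub>?B\<^esub> = h (?r 0)"
      unfolding h_0 by (rule quot_class_0[symmetric])
    then have "\<zero>\<^bsub>?B\<^esub> \<in> h ` carrier ?R"
      by (rule image_eqI) simp
    then show ?thesis by (simp add: coeffs_def)
  qed
  ultimately have "\<gamma> = (\<lambda>_. \<zero>\<^bsub>?B\<^esub>)"
    by blast
  then have "\<gamma> k = ?b 0" for k
    unfolding quot_class_0 by (rule fun_cong)
  then have "h (?r (\<rho> k)) = h (?r 0)" for k
    unfolding h_0 \<gamma>_def .
  then have \<rho>_0: "?r (\<rho> k) = ?r 0" for k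
    by (rule inj_onD[OF inj]) simp_all
  have "\<kappa> k a b = 0" if "(a, b) \<in> Box" for k a b
    by (rule plane_monomials_independent[OF Box \<rho>_0[unfolded R_rels_def \<rho>_def] that])
  \<comment> \<open>Exponents outside the box have coefficient 0 by \<open>bound\<close>.\<close>
  then have "Poly_Mapping.lookup v (normal_word a b c d) = 0" for a b c d
    using bound[of a b c d] by (fastforce simp: \<kappa>_def Box_def)
  then have "Poly_Mapping.lookup v u = 0" for u
    using keys by (cases "u \<in> normal_words") (auto simp: in_keys_iff)
  then show ?thesis
    by (intro poly_mapping_eqI) simp
qed

section \<open>Spanning by the normal monomials\<close>

definition normal_monos :: "(gen, 'k::field) free_alg set" where
  "normal_monos = {normal_mono a b c d |a b c d. True}"

context
  fixes F :: family and p q f g :: "'k::field"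
begin

abbreviation (input) cls :: "(gen, 'k) free_alg \<Rightarrow> (gen, 'k) free_alg set" where
  "cls \<equiv> quot_class (B_rels F p q f g)"

lemma x_relation: "plane_relation xv (x_params F p q) \<in> B_rels F p q f g"
  by (simp add: B_rels_def)

lemma y_relation: "plane_relation yv (y_params F p q) \<in> B_rels F p q f g"
  by (simp add: B_rels_def)

lemma yx_relation:
  "cls (yv i * xv s) = cls (\<Sum>(l, t, u)\<in>coupling F p q f g i s. scalar l * xv t * yv u)"
  by (rule quot_class_relation) (auto simp: B_rels_def)

abbreviation (input) nspan :: "(gen, 'k) free_alg set" where
  "nspan \<equiv> mod_span (B_rels F p q f g) normal_monos"

lemma normal_mono_in_nspan: "normal_mono a b c d \<in> nspan"
  by (rule mod_span_base) (auto simp: normal_monos_def)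

text \<open>Only \<open>xv I2\<close> in front of a power of \<open>xv I1\<close> is out of order,
  and \<open>mult_letter_power\<close> resolves this into two normal monomials.\<close>

lemma x_mult_nspan:
  assumes "v \<in> nspan"
  shows "xv s * v \<in> nspan"
proof (rule mod_span_mult[OF _ assms])
  fix m :: "(gen, 'k) free_alg"
  assume "m \<in> normal_monos"
  then obtain a b c d where m: "m = normal_mono a b c d"
    by (auto simp: normal_monos_def)
  show "xv s * m \<in> nspan"
  proof (cases s)
    case I1
    then have "xv s * m = normal_mono (Suc a) b c d"
      by (simp add: m normal_mono_def mult.assoc)
    then show ?thesis by (simp only: normal_mono_in_nspan)
  next
    case I2
    obtain q' r' where qr: "x_params F p q = (q', r')" by fastforce
    let ?w = "xv I2 ^ b * yv I1 ^ c * yv I2 ^ d :: (gen, 'k) free_alg"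
    let ?v = "(scalar (q' ^ a) * xv I1 ^ a * xv I2 + scalar (r' * q_int q' a) * xv I1 ^ Suc a) * ?w"
    have eq: "cls ?v = cls ((xv I2 * xv I1 ^ a) * ?w)"
      by (intro quot_class_mult_cong mult_letter_power[symmetric] refl) (use x_relation qr in simp)
    have "?v =
        scalar (q' ^ a) * normal_mono a (Suc b) c d + scalar (r' * q_int q' a) * normal_mono (Suc a) b c d"
      by (simp add: normal_mono_def distrib_right mult.assoc)
    then have "?v \<in> nspan"
      by (simp only: mod_span_add mod_span_scalar normal_mono_in_nspan)
    from this eq have "(xv I2 * xv I1 ^ a) * ?w \<in> nspan"
      by (rule mod_span.eq)
    then show ?thesis
      by (simp add: m I2 normal_mono_def mult.assoc)
  qed
qed

lemma y_mult_y_nspan: "yv i * (yv I1 ^ c * yv I2 ^ d) \<in> nspan"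
proof (cases i)
  case I1
  then have "yv i * (yv I1 ^ c * yv I2 ^ d) = (normal_mono 0 0 (Suc c) d :: (gen, 'k) free_alg)"
    by (simp add: normal_mono_def mult.assoc)
  then show ?thesis by (simp only: normal_mono_in_nspan)
next
  case I2
  obtain p' s' where ps: "y_params F p q = (p', s')" by fastforce
  let ?v = "(scalar (p' ^ c) * yv I1 ^ c * yv I2 + scalar (s' * q_int p' c) * yv I1 ^ Suc c) * yv I2 ^ d"
  have "cls ?v = cls ((yv I2 * yv I1 ^ c) * yv I2 ^ d)"
    by (intro quot_class_mult_cong mult_letter_power[symmetric] refl) (use y_relation ps in simp)
  moreover have "?v = scalar (p' ^ c) * normal_mono 0 0 c (Suc d) + scalar (s' * q_int p' c) * normal_mono 0 0 (Suc c) d"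
    by (simp add: normal_mono_def distrib_right mult.assoc)
  then have "?v \<in> nspan"
    by (simp only: mod_span_add mod_span_scalar normal_mono_in_nspan)
  ultimately show ?thesis
    unfolding I2 mult.assoc[symmetric] by (rule mod_span.eq[rotated])
qed

text \<open>The coupling relation turns y_i x_s w into a combination of terms x_t (y_u w). As it
  mixes y_1 and y_2, the hypothesis covers both values of \<open>u\<close>.\<close>

lemma y_mult_nspan_step:
  assumes "\<And>u. yv u * w \<in> nspan"
  shows "yv i * (xv s * w) \<in> nspan"
proof -
  have "(\<Sum>(l, t, u)\<in>coupling F p q f g i s. scalar l * xv t * yv u) * w =
    (\<Sum>(l, t, u)\<in>coupling F p q f g i s. scalar l * (xv t * (yv u * w)))"
    unfolding sum_distrib_right by (intro sum.cong refl) (auto simp: mult.assoc)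
  also have "\<dots> \<in> nspan"
    by (intro mod_span_sum) (auto simp: assms intro!: mod_span_scalar x_mult_nspan)
  finally show ?thesis
    unfolding mult.assoc[symmetric]
    by (rule mod_span.eq) (intro quot_class_mult_cong yx_relation[symmetric] refl)
qed

lemma y_mult_nspan:
  assumes "v \<in> nspan"
  shows "yv i * v \<in> nspan"
proof (rule mod_span_mult[OF _ assms])
  fix m :: "(gen, 'k) free_alg"
  assume "m \<in> normal_monos"
  then obtain a b c d where m: "m = normal_mono a b c d"
    by (auto simp: normal_monos_def)
  \<comment> \<open>The y-letter passes the x-letters one at a time. In both inductions
    \<open>u\<close> is arbitrary because each exchange can change the y-letter; the base case, with
    no x-letter left, is \<open>y_mult_y_nspan\<close>.\<close>
  have 1: "yv u * (xv I2 ^ b * (yv I1 ^ c * yv I2 ^ d)) \<in> nspan" for u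
  proof (induction b arbitrary: u)
    case 0
    show ?case using y_mult_y_nspan by simp
  next
    case (Suc b)
    then show ?case unfolding power_Suc mult.assoc by (intro y_mult_nspan_step)
  qed
  have "yv u * (xv I1 ^ a * (xv I2 ^ b * (yv I1 ^ c * yv I2 ^ d))) \<in> nspan" for u
  proof (induction a arbitrary: u)
    case 0
    show ?case by (simp add: 1)
  next
    case (Suc b)
    then show ?case unfolding power_Suc mult.assoc by (intro y_mult_nspan_step)
  qed
  then show "yv i * m \<in> nspan"
    by (simp add: m normal_mono_def mult.assoc)
qed

text \<open>Every word arises from the empty word, itself a normal monomial, by left multiplication
  with letters, and the span is stable under that.\<close>

lemma in_nspan: "w \<in> nspan"
proof (induction w rule: poly_mapping_single_add_induct)
  case (single u c)
  obtain l where u: "u = Word l" by (cases u)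
  have "Poly_Mapping.single (Word l) 1 \<in> nspan"
  proof (induction l)
    case Nil
    have "Poly_Mapping.single (Word []) 1 = (normal_mono 0 0 0 0 :: (gen, 'k) free_alg)"
      by (simp add: normal_mono_def flip: zero_fword_def)
    then show ?case by (simp only: normal_mono_in_nspan)
  next
    case (Cons s l)
    have "Poly_Mapping.single (Word (s # l)) 1 = letter s * Poly_Mapping.single (Word l) (1 :: 'k)"
      by (simp add: letter_def mult_single)
    with Cons show ?case
      by (cases s) (simp_all add: x_mult_nspan y_mult_nspan)
  qed
  then have "scalar c * Poly_Mapping.single (Word l) 1 \<in> nspan"
    by (rule mod_span_scalar)
  then show ?case by (simp add: u scalar_def mult_single)
next
  case (add v w)
  then show ?case by (rule mod_span_add)
qed

lemma normal_form_exists: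
  "\<exists>v. Poly_Mapping.keys v \<subseteq> normal_words \<and> cls v = cls w"
  using in_nspan[of w]
proof (induction w rule: mod_span.induct)
  case zero
  show ?case by (intro exI[of _ 0]) simp
next
  case (add m v c)
  then obtain v' where v': "Poly_Mapping.keys v' \<subseteq> normal_words" "cls v' = cls v" by blast
  obtain a b c' d where m: "m = normal_mono a b c' d" using add by (auto simp: normal_monos_def)
  have "scalar c * m = Poly_Mapping.single (normal_word a b c' d) c"
    by (simp add: m normal_mono_eq_single scalar_def mult_single)
  then have "Poly_Mapping.keys (scalar c * m) \<subseteq> normal_words"
    by auto
  then have "Poly_Mapping.keys (scalar c * m + v') \<subseteq> normal_words"
    using v'(1) by (intro order_trans[OF keys_add] Un_least)
  moreover have "cls (scalar c * m + v') = cls (scalar c * m + v)"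
    by (intro quot_class_add_cong v' refl)
  ultimately show ?case by blast
next
  case (eq v w)
  then show ?case by auto
qed

section \<open>The normal form for admissible parameters\<close>

context
  assumes adm: "admissible F p q f g"
begin

lemma normal_form_unique:
  assumes "Poly_Mapping.keys v \<subseteq> normal_words" "Poly_Mapping.keys w \<subseteq> normal_words"
    and "cls v = cls w"
  shows "v = w"
proof -
  have "v - w = 0"
  proof (rule normal_form_unique_0[OF adm])
    show "Poly_Mapping.keys (v - w) \<subseteq> normal_words"
      using assms(1,2) by (intro order_trans[OF keys_diff] Un_least)
    show "cls (v - w) = cls 0"
      using assms(3) by (simp add: quot_class_eq_iff)
  qed
  then show ?thesis by simp
qed

text \<open>Uniqueness makes the definite description denote; from here on \<open>NF\<close> is
  computed by exhibiting any normally supported element of the same class.\<close>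

lemma NF_eqI:
  assumes "Poly_Mapping.keys v \<subseteq> normal_words" "cls v = cls w"
  shows "NF F p q f g w = v"
  unfolding NF_def by (rule the_equality) (use assms normal_form_unique in auto)

lemma NF_normal: "Poly_Mapping.keys (NF F p q f g w) \<subseteq> normal_words"
  and cls_NF: "cls (NF F p q f g w) = cls w"
proof -
  obtain v where v: "Poly_Mapping.keys v \<subseteq> normal_words" "cls v = cls w"
    using normal_form_exists by blast
  then have "NF F p q f g w = v" by (rule NF_eqI)
  with v show "Poly_Mapping.keys (NF F p q f g w) \<subseteq> normal_words" "cls (NF F p q f g w) = cls w"
    by simp_all
qed

lemma NF_expansion:
  "NF F p q f g (yv I1 ^ c * yv I2 ^ d * xv I1 ^ a * xv I2 ^ b) =
    (\<Sum>(\<alpha>, \<beta>, \<gamma>, \<delta>)\<in>{(\<alpha>, \<beta>, \<gamma>, \<delta>). Theta F p q f g a b c d \<alpha> \<beta> \<gamma> \<delta> \<noteq> 0}.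
      scalar (Theta F p q f g a b c d \<alpha> \<beta> \<gamma> \<delta>) * normal_mono \<alpha> \<beta> \<gamma> \<delta>)"
  unfolding Theta_def by (rule normal_expansion[OF NF_normal finite_normal_support]) simp

end

text \<open>After regrouping, only x_2^b x_1^\<alpha> and y_2^\<delta> y_1^c are out of order. Each
  is rewritten within its own plane, and the resulting products are already normal.\<close>

lemma monomial_sandwich:
  "cls (xv I1 ^ a * xv I2 ^ b * normal_mono \<alpha> \<beta> \<gamma> \<delta> * (yv I1 ^ c * yv I2 ^ d)) =
    cls (\<Sum>(r, s)\<in>{..b} \<times> {..\<delta>}.
      scalar (Lambda (x_params F p q) b \<alpha> r * Lambda (y_params F p q) \<delta> c s) *
      normal_mono (a + \<alpha> + r) (b - r + \<beta>) (\<gamma> + c + s) (\<delta> - s + d))"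
proof -
  let ?X = "\<Sum>r\<le>b. scalar (Lambda (x_params F p q) b \<alpha> r) * xv I1 ^ (\<alpha> + r) * xv I2 ^ (b - r)"
  let ?Y = "\<Sum>s\<le>\<delta>. scalar (Lambda (y_params F p q) \<delta> c s) * yv I1 ^ (c + s) * yv I2 ^ (\<delta> - s)"
  have "cls (xv I1 ^ a * xv I2 ^ b * normal_mono \<alpha> \<beta> \<gamma> \<delta> * (yv I1 ^ c * yv I2 ^ d)) =
      cls (xv I1 ^ a * (xv I2 ^ b * xv I1 ^ \<alpha>) * (xv I2 ^ \<beta> * yv I1 ^ \<gamma>) *
        (yv I2 ^ \<delta> * yv I1 ^ c) * yv I2 ^ d)"
    by (simp add: normal_mono_def mult.assoc)
  also have "\<dots> = cls (xv I1 ^ a * ?X * (xv I2 ^ \<beta> * yv I1 ^ \<gamma>) * ?Y * yv I2 ^ d)"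
    by (intro quot_class_mult_cong refl power_mult_letter_power x_relation y_relation)
  also have "xv I1 ^ a * ?X * (xv I2 ^ \<beta> * yv I1 ^ \<gamma>) * ?Y * yv I2 ^ d =
    (\<Sum>(r, s)\<in>{..b} \<times> {..\<delta>}.
      scalar (Lambda (x_params F p q) b \<alpha> r * Lambda (y_params F p q) \<delta> c s) *
      normal_mono (a + \<alpha> + r) (b - r + \<beta>) (\<gamma> + c + s) (\<delta> - s + d))"
    unfolding sum_distrib_left sum_distrib_right sum.cartesian_product[symmetric]
    by (subst sum.swap, intro sum.cong refl)
      (simp add: normal_mono_def power_add scalar_scalar mult.assoc
        scalar_left_commute[of "letter _ ^ _"] del: add_diff_assoc2)
  finally show ?thesis .
qed

end

section \<open>Product constants\<close>

theorem proposition3p8: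
  fixes F :: family
    and p q f g :: "'k::{alg_closed_field, field_char_0}"
    and a b c d a' b' c' d' :: nat
  assumes "admissible F p q f g"
  shows "(\<forall>A B C D. finite {z. product_const_term F p q f g
              (a, b, c, d) (a', b', c', d') (A, B, C, D) z \<noteq> 0}) \<and>
         finite {P. product_const F p q f g (a, b, c, d) (a', b', c', d') P \<noteq> 0} \<and>
         NF F p q f g (normal_mono a b c d * normal_mono a' b' c' d') =
           Sum_any (\<lambda>(A, B, C, D).
             scalar (product_const F p q f g (a, b, c, d) (a', b', c', d') (A, B, C, D)) *
             normal_mono A B C D)"
proof -
  let ?cls = "quot_class (B_rels F p q f g)"
  define \<Theta> where "\<Theta> = (\<lambda>(\<alpha>, \<beta>, \<gamma>, \<delta>). Theta F p q f g a' b' c d \<alpha> \<beta> \<gamma> \<delta>)"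
  define S where "S = {t. \<Theta> t \<noteq> 0}"
  have S: "finite S"
  proof -
    have "S = {(\<alpha>, \<beta>, \<gamma>, \<delta>). Theta F p q f g a' b' c d \<alpha> \<beta> \<gamma> \<delta> \<noteq> 0}"
      by (auto simp: S_def \<Theta>_def)
    then show ?thesis
      unfolding Theta_def by (simp only: finite_normal_support)
  qed
  define summand where "summand = product_const_term F p q f g (a, b, c, d) (a', b', c', d')"
  define const where "const = product_const F p q f g (a, b, c, d) (a', b', c', d')"
  \<comment> \<open>\<open>Z\<close> contains every index with a nonzero summand, as
    \<open>Lambda\<close> vanishes for r > b and for s > \<delta>. On \<open>Z\<close> the truncated
    differences in \<open>idx\<close> agree with the integer differences in the Kronecker
    deltas.\<close>
  define Z where "Z = {(\<alpha>, \<beta>, \<gamma>, \<delta>, r, s). (\<alpha>, \<beta>, \<gamma>, \<delta>) \<in> S \<and> r \<le> b \<and> s \<le> \<delta>}"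
  define coef where "coef = (\<lambda>(\<alpha>, \<beta>, \<gamma>, \<delta>, r, s). \<Theta> (\<alpha>, \<beta>, \<gamma>, \<delta>) *
    (Lambda (x_params F p q) b \<alpha> r * Lambda (y_params F p q) \<delta> c' s))"
  define idx where "idx = (\<lambda>(\<alpha>::nat, \<beta>::nat, \<gamma>::nat, \<delta>::nat, r::nat, s::nat).
    (a + \<alpha> + r, b - r + \<beta>, \<gamma> + c' + s, \<delta> - s + d'))"
  define mono :: "nat \<times> nat \<times> nat \<times> nat \<Rightarrow> (gen, 'k) free_alg"
    where "mono = (\<lambda>(A, B, C, D). normal_mono A B C D)"
  \<comment> \<open>Dependent pairs are flattened to six-tuples, so that the iterated sum produced
    by the reordering becomes one sum over \<open>Z\<close>.\<close>
  define flat :: "(nat \<times> nat \<times> nat \<times> nat) \<times> nat \<times> nat \<Rightarrow> nat \<times> nat \<times> nat \<times> nat \<times> nat \<times> nat"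
    where "flat = (\<lambda>((\<alpha>, \<beta>, \<gamma>, \<delta>), (r, s)). (\<alpha>, \<beta>, \<gamma>, \<delta>, r, s))"
  have Z_flat: "Z = flat ` (SIGMA (\<alpha>, \<beta>, \<gamma>, \<delta>):S. {..b} \<times> {..\<delta>})"
    by (force simp: Z_def flat_def)
  have Z: "finite Z"
    unfolding Z_flat using S by (intro finite_imageI finite_SigmaI) (auto split: prod.split)
  have summand_outside: "summand P z = 0" if "z \<notin> Z" for P z
    using that by (cases P; cases z)
      (auto simp: summand_def product_const_term_def Z_def S_def \<Theta>_def Lambda_eq_0 not_le)
  \<comment> \<open>The four Kronecker deltas together say that \<open>idx z\<close> is the index of
    the target monomial.\<close>
  have summand_inside: "summand P z = (if idx z = P then coef z else 0)" if "z \<in> Z" for P z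
    using that by (cases P; cases z)
      (auto simp: summand_def product_const_term_def Z_def coef_def idx_def \<Theta>_def kdelta_def of_nat_diff)
  have const: "const P = (\<Sum>z\<in>Z. if idx z = P then coef z else 0)" for P
  proof -
    have "const P = sum (summand P) Z"
      unfolding const_def product_const_def summand_def[symmetric]
      using summand_outside by (intro Sum_any.expand_superset Z) blast
    then show ?thesis using summand_inside by simp
  qed
  have const_outside: "const P = 0" if "P \<notin> idx ` Z" for P
    unfolding const by (rule sum.neutral) (use that in auto)
  have support: "{P. const P \<noteq> 0} \<subseteq> idx ` Z"
    using const_outside by blast

  have "Sum_any (\<lambda>P. scalar (const P) * mono P) = (\<Sum>P\<in>idx ` Z. scalar (const P) * mono P)"
    by (intro Sum_any.expand_superset finite_imageI Z order_trans[OF _ support]) auto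
  \<comment> \<open>Each \<open>z\<close> contributes to the single monomial with index
    \<open>idx z\<close>, so exchanging the sums collapses the inner one.\<close>
  also have "\<dots> = (\<Sum>P\<in>idx ` Z. \<Sum>z\<in>Z. if idx z = P then scalar (coef z) * mono P else 0)"
    unfolding const scalar_sum sum_distrib_right by (intro sum.cong refl) simp
  also have "\<dots> = (\<Sum>z\<in>Z. scalar (coef z) * mono (idx z))"
    using Z by (subst sum.swap) (intro sum.cong refl, simp)
  finally have Sum_any: "Sum_any (\<lambda>P. scalar (const P) * mono P) =
    (\<Sum>z\<in>Z. scalar (coef z) * mono (idx z))" .

  let ?x = "xv I1 ^ a * xv I2 ^ b :: (gen, 'k) free_alg"
  let ?y = "yv I1 ^ c' * yv I2 ^ d' :: (gen, 'k) free_alg"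
  let ?w = "yv I1 ^ c * yv I2 ^ d * xv I1 ^ a' * xv I2 ^ b' :: (gen, 'k) free_alg"
  have NF_w: "NF F p q f g ?w = (\<Sum>t\<in>S. scalar (\<Theta> t) * mono t)"
    unfolding NF_expansion[OF assms] S_def
    by (intro sum.cong) (auto simp: \<Theta>_def mono_def)
  have "?cls (normal_mono a b c d * normal_mono a' b' c' d') = ?cls (?x * ?w * ?y)"
    by (simp add: normal_mono_def mult.assoc)
  \<comment> \<open>The middle factor is exactly the product whose normal form defines
    \<open>Theta\<close>, and it has the same class as that normal form.\<close>
  also have "\<dots> = ?cls (?x * NF F p q f g ?w * ?y)"
    by (intro quot_class_mult_cong refl cls_NF[OF assms, symmetric])
  also have "?x * NF F p q f g ?w * ?y = (\<Sum>t\<in>S. scalar (\<Theta> t) * (?x * mono t * ?y))"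
    unfolding NF_w sum_distrib_left sum_distrib_right
    by (simp add: scalar_left_commute[of "letter _ ^ _"] mult.assoc)
  also have "?cls \<dots> = ?cls (\<Sum>(\<alpha>, \<beta>, \<gamma>, \<delta>)\<in>S. scalar (\<Theta> (\<alpha>, \<beta>, \<gamma>, \<delta>)) *
      (\<Sum>(r, s)\<in>{..b} \<times> {..\<delta>}.
        scalar (Lambda (x_params F p q) b \<alpha> r * Lambda (y_params F p q) \<delta> c' s) *
        normal_mono (a + \<alpha> + r) (b - r + \<beta>) (\<gamma> + c' + s) (\<delta> - s + d')))"
    by (rule quot_class_sum_cong)
      (auto simp: mono_def intro!: quot_class_mult_cong monomial_sandwich)
  also have "\<dots> = ?cls (\<Sum>z\<in>Z. scalar (coef z) * mono (idx z))"
  proof -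
    have "(\<Sum>(\<alpha>, \<beta>, \<gamma>, \<delta>)\<in>S. scalar (\<Theta> (\<alpha>, \<beta>, \<gamma>, \<delta>)) *
      (\<Sum>(r, s)\<in>{..b} \<times> {..\<delta>}.
        scalar (Lambda (x_params F p q) b \<alpha> r * Lambda (y_params F p q) \<delta> c' s) *
        normal_mono (a + \<alpha> + r) (b - r + \<beta>) (\<gamma> + c' + s) (\<delta> - s + d'))) =
      (\<Sum>t\<in>S. \<Sum>w\<in>(case t of (\<alpha>, \<beta>, \<gamma>, \<delta>) \<Rightarrow> {..b} \<times> {..\<delta>}).
        scalar (coef (flat (t, w))) * mono (idx (flat (t, w))))"
      by (intro sum.cong refl)
        (auto simp: sum_distrib_left scalar_scalar coef_def flat_def idx_def mono_def intro!: sum.cong)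
    also have "\<dots> = (\<Sum>z\<in>Z. scalar (coef z) * mono (idx z))"
      unfolding Z_flat
      using S by (subst sum.Sigma; (subst sum.reindex)?)
        (auto simp: flat_def inj_on_def intro!: sum.cong)
    finally show ?thesis by simp
  qed
  \<comment> \<open>The sum over \<open>Z\<close> is supported on normal words and lies in the class
    of the product, so it is the normal form.\<close>
  finally have "NF F p q f g (normal_mono a b c d * normal_mono a' b' c' d') =
    (\<Sum>z\<in>Z. scalar (coef z) * mono (idx z))"
  proof (intro NF_eqI[OF assms] order_trans[OF keys_sum])
    show "(\<Union>z\<in>Z. Poly_Mapping.keys (scalar (coef z) * mono (idx z))) \<subseteq> normal_words"
    proof (rule UN_least)
      fix z
      obtain A B C D where "idx z = (A, B, C, D)" by (cases "idx z")
      then show "Poly_Mapping.keys (scalar (coef z) * mono (idx z)) \<subseteq> normal_words"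
        by (auto simp: mono_def normal_mono_eq_single scalar_def mult_single)
    qed
  qed simp
  moreover have "(\<lambda>(A, B, C, D). scalar (const (A, B, C, D)) * normal_mono A B C D) =
      (\<lambda>P. scalar (const P) * mono P)"
    by (auto simp: mono_def)
  moreover have "finite {z. summand P z \<noteq> 0}" for P
    using Z summand_outside by (rule_tac finite_subset[of _ Z]) blast+
  moreover have "finite {P. const P \<noteq> 0}"
    using support Z by (rule finite_subset[OF _ finite_imageI])
  ultimately show ?thesis
    using Sum_any unfolding summand_def const_def by simp
qed

end
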